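(* Let $\mathscr{M}A=M(A)\rtimes A$ and $\mathscr{N}B=N(B)\rtimes B$ be two finitely generated halo products, with $A,B$ infinite, with $\mathscr{M},\mathscr{N}$ charming and with $M(A),N(B)$ locally finite. If there exists an aptolic quasi-isometry $\mathscr{M}A\to\mathscr{N}B$, then the lamp growth sequence $\Lambda_{\mathscr{M}}$ is $\mathbb{B}$-interlaced with $\Lambda_{\mathscr{N}}$, where $\mathbb{B}$ denotes the boundary growth of $A$.
   Context: Halo products: let $H$ be a group. A halo of groups $\mathscr{L}$ over $H$ is the data, for every subset $S \subset H$, of a group $L(S)$ such that: (i) if $R \subset S \subset H$ then $L(R) \leq L(S)$; (ii) $L(\emptyset)=\{1\}$ and $L(H)=\langle L(S) : S \subset H \text{ finite}\rangle$; (iii) $L(R)\cap L(S)=L(R\cap S)$ for all $R,S\subset H$. Given a morphism $\alpha : H \to \mathrm{Aut}(L(H))$ with $\alpha(h)(L(S))=L(hS)$ for all $h\in H$, $S\subset H$, the halo product $\mathscr{L}H$ is the semidirect product $L(H)\rtimes_\alpha H$; its elements are written $(c,p)$ with $c\in L(H)$, $p\in H$. For the halos $\mathscr{M}$ over $A$ and $\mathscr{N}$ over $B$ the groups are denoted $M(S)$, $N(S)$. Finitely generated groups are endowed with finite generating sets and identified with the corresponding Cayley graphs and word metrics. Charming: a halo of groups $\mathscr{L}$ over a connected graph $X$ (vertex set) is charming if (a) there is $D\ge 0$ such that $L(S)\subset\left\langle\bigcup_{s\in S}L(B(s,D))\right\rangle$ for every connected $S\subset X$; (b) for $S$ connected,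 the size of $L(S)$ only depends on the size of $S$. Lamp growth sequence of a charming $\mathscr{L}$ over an infinite connected locally finite graph $X$ with $L(X)$ locally finite: $\Lambda_{\mathscr{L}}(n)=|L(S)|$ where $S\subset X$ is any connected subset with $|S|=n$. Aptolic quasi-isometry: a quasi-isometry $\Psi:\mathscr{M}A\to\mathscr{N}B$ for which there exist a bijection $\alpha:M(A)\to N(B)$ and a quasi-isometry $\beta:A\to B$ with $\Psi(c,p)=(\alpha(c),\beta(p))$ for all $(c,p)$. Boundary growth of a locally finite graph $X$: $\mathbb{B}(n)=\min\{|\partial S| : S\subset X\text{ connected of size }n\}$, where $\partial S$ is the set of vertices outside $S$ adjacent to a vertex of $S$. Interlaced: given $\Delta:\mathbb{N}\to\mathbb{N}$ and $\varphi,\psi:\mathbb{N}\to\mathbb{N}$, $\varphi$ is $\Delta$-interlaced with $\psi$ if there exist an integer $C\ge 0$ and a sequence $(x_n)$ of integers with $x_n=\Theta(n)$ (i.e. bounded above and below by positive constant multiples of $n$) such that $\varphi(n)$ divides $\psi(x_n)$, and $\psi(x_n)$ divides $\varphi(n+C\cdot\Delta(n))$, for every $n\ge 1$.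
   Formalization: The formal statement also assumes that M(S) and N(S) are finite for every finite connected S; this does not follow from local finiteness of M(A) and N(B), and without it the lamp growth sequences need not take values in the natural numbers. *)

theory Defs
  imports Complex_Main "HOL-Algebra.Bij" "HOL-Algebra.Generated_Groups" "HOL-Library.Equipollence"
begin

section \<open>Graphs\<close>

text \<open>
  A graph is given by a vertex set \<open>X\<close> and a symmetric, irreflexive adjacency relation \<open>E\<close> on \<open>X\<close>.
\<close>

definition graph_dist :: "('v \<times> 'v) set \<Rightarrow> 'v \<Rightarrow> 'v \<Rightarrow> nat"
  where "graph_dist E x y = (LEAST n. (x, y) \<in> E ^^ n)"
  \<comment> \<open>Only meaningful when \<open>x\<close> and \<open>y\<close> are joined by a path; it is used on connected graphs only.\<close>

definition graph_ball :: "'v set \<Rightarrow> ('v \<times> 'v) set \<Rightarrow> 'v \<Rightarrow> nat \<Rightarrow> 'v set"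
  where "graph_ball X E x r = {y \<in> X. graph_dist E x y \<le> r}"

definition connected_subset :: "'v set \<Rightarrow> ('v \<times> 'v) set \<Rightarrow> 'v set \<Rightarrow> bool"
  where "connected_subset X E S \<longleftrightarrow>
    S \<subseteq> X \<and> (\<forall>x\<in>S. \<forall>y\<in>S. (x, y) \<in> (E \<inter> S \<times> S)\<^sup>*)"

definition vertex_boundary :: "'v set \<Rightarrow> ('v \<times> 'v) set \<Rightarrow> 'v set \<Rightarrow> 'v set"
  where "vertex_boundary X E S = {y \<in> X - S. \<exists>x\<in>S. (x, y) \<in> E}"

definition boundary_growth :: "'v set \<Rightarrow> ('v \<times> 'v) set \<Rightarrow> nat \<Rightarrow> nat"
  where "boundary_growth X E n =
    Inf {card (vertex_boundary X E S) |S. connected_subset X E S \<and> finite S \<and> card S = n}"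

definition quasi_isometry ::
  "'v set \<Rightarrow> ('v \<times> 'v) set \<Rightarrow> 'w set \<Rightarrow> ('w \<times> 'w) set \<Rightarrow> ('v \<Rightarrow> 'w) \<Rightarrow> bool"
  where "quasi_isometry X E Y F f \<longleftrightarrow>
    f \<in> X \<rightarrow> Y \<and>
    (\<exists>K C :: real. K \<ge> 1 \<and> C \<ge> 0 \<and>
      (\<forall>x\<in>X. \<forall>x'\<in>X.
         real (graph_dist E x x') / K - C \<le> real (graph_dist F (f x) (f x')) \<and>
         real (graph_dist F (f x) (f x')) \<le> K * real (graph_dist E x x') + C) \<and>
      (\<forall>y\<in>Y. \<exists>x\<in>X. real (graph_dist F (f x) y) \<le> C))"

section \<open>Finitely generated and locally finite groups\<close>

definition finite_generating_set :: "('g, 'r) monoid_scheme \<Rightarrow> 'g set \<Rightarrow> bool"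
  where "finite_generating_set G T \<longleftrightarrow>
    finite T \<and> T \<subseteq> carrier G \<and> generate G T = carrier G"

text \<open>
  \<open>T\<close> is not required to be symmetric, so both directions are included.
  Right multiplication by generators makes left translations graph automorphisms.
\<close>

definition cayley_edges :: "('g, 'r) monoid_scheme \<Rightarrow> 'g set \<Rightarrow> ('g \<times> 'g) set"
  where "cayley_edges G T =
    {(g, h). g \<in> carrier G \<and> h \<in> carrier G \<and> g \<noteq> h \<and>
             (\<exists>t\<in>T. h = g \<otimes>\<^bsub>G\<^esub> t \<or> g = h \<otimes>\<^bsub>G\<^esub> t)}"

definition locally_finite_group :: "('g, 'r) monoid_scheme \<Rightarrow> bool"
  where "locally_finite_group G \<longleftrightarrow>
    (\<forall>F. F \<subseteq> carrier G \<and> finite F \<longrightarrow> finite (generate G F))"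

section \<open>Halo products\<close>

text \<open>
  All the groups \<open>L S\<close> are subgroups of the group attached to the whole vertex set \<open>X\<close>;
  \<open>G\<close> is that group and \<open>L S\<close> is the underlying set of the subgroup attached to \<open>S\<close>.
  Nothing is said about \<open>L S\<close> when \<open>S\<close> is not contained in \<open>X\<close>.
\<close>

locale halo = group G
  for X :: "'v set" and G :: "('g, 'r) monoid_scheme" (structure) and L :: "'v set \<Rightarrow> 'g set" +
  assumes halo_subgroup: "S \<subseteq> X \<Longrightarrow> subgroup (L S) G"
    and halo_whole: "L X = carrier G"
    and halo_mono: "R \<subseteq> S \<Longrightarrow> S \<subseteq> X \<Longrightarrow> L R \<subseteq> L S"
    and halo_empty: "L {} = {\<one>}"
    and halo_generated: "L X = generate G (\<Union>{L S |S. S \<subseteq> X \<and> finite S})"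
    and halo_Int: "R \<subseteq> X \<Longrightarrow> S \<subseteq> X \<Longrightarrow> L R \<inter> L S = L (R \<inter> S)"

definition semidirect_product ::
  "('g, 'r) monoid_scheme \<Rightarrow> ('h, 's) monoid_scheme \<Rightarrow> ('h \<Rightarrow> 'g \<Rightarrow> 'g) \<Rightarrow> ('g \<times> 'h) monoid"
  where "semidirect_product G H \<alpha> =
    \<lparr>carrier = carrier G \<times> carrier H,
     mult = (\<lambda>(c, p) (d, q). (c \<otimes>\<^bsub>G\<^esub> \<alpha> p d, p \<otimes>\<^bsub>H\<^esub> q)),
     one = (\<one>\<^bsub>G\<^esub>, \<one>\<^bsub>H\<^esub>)\<rparr>"

locale halo_product =
  halo "carrier H" G L + base: group H
  for H :: "('h, 's) monoid_scheme" and G :: "('g, 'r) monoid_scheme"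
    and L :: "'h set \<Rightarrow> 'g set" and \<alpha> :: "'h \<Rightarrow> 'g \<Rightarrow> 'g" +
  assumes action: "\<alpha> \<in> hom H (AutoGroup G)"
    and action_halo: "h \<in> carrier H \<Longrightarrow> S \<subseteq> carrier H \<Longrightarrow> \<alpha> h ` L S = L (h <#\<^bsub>H\<^esub> S)"
begin

lemma action_auto: "h \<in> carrier H \<Longrightarrow> \<alpha> h \<in> auto G"
  using action by (auto simp: hom_def AutoGroup_def)

lemma action_closed: "h \<in> carrier H \<Longrightarrow> c \<in> carrier G \<Longrightarrow> \<alpha> h c \<in> carrier G"
  using action_auto[of h] by (auto simp: auto_def hom_def)

lemma action_mult:
  "h \<in> carrier H \<Longrightarrow> c \<in> carrier G \<Longrightarrow> d \<in> carrier G \<Longrightarrow>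
    \<alpha> h (c \<otimes>\<^bsub>G\<^esub> d) = \<alpha> h c \<otimes>\<^bsub>G\<^esub> \<alpha> h d"
  using action_auto[of h] by (auto simp: auto_def hom_def)

lemma action_comp:
  assumes "h \<in> carrier H" "k \<in> carrier H" "c \<in> carrier G"
  shows "\<alpha> (h \<otimes>\<^bsub>H\<^esub> k) c = \<alpha> h (\<alpha> k c)"
proof -
  have "\<alpha> h \<in> Bij (carrier G)" "\<alpha> k \<in> Bij (carrier G)"
    using action_auto assms by (auto simp: auto_def)
  moreover have "\<alpha> (h \<otimes>\<^bsub>H\<^esub> k) = \<alpha> h \<otimes>\<^bsub>AutoGroup G\<^esub> \<alpha> k"
    using action assms by (simp add: hom_def)
  ultimately show ?thesis
    using assms by (simp add: AutoGroup_def BijGroup_def compose_def)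
qed

lemma action_one:
  assumes "c \<in> carrier G"
  shows "\<alpha> \<one>\<^bsub>H\<^esub> c = c"
proof -
  have "group_hom H (AutoGroup G) \<alpha>"
    using action AutoGroup base.is_group
    by (simp add: group_hom_def group_hom_axioms_def)
  then have "\<alpha> \<one>\<^bsub>H\<^esub> = \<one>\<^bsub>AutoGroup G\<^esub>"
    by (rule group_hom.hom_one)
  then show ?thesis
    using assms by (simp add: AutoGroup_def BijGroup_def)
qed

lemma group_semidirect_product: "group (semidirect_product G H \<alpha>)"
proof (rule groupI)
  fix x
  assume "x \<in> carrier (semidirect_product G H \<alpha>)"
  then obtain c p where x: "x = (c, p)" "c \<in> carrier G" "p \<in> carrier H"
    by (auto simp: semidirect_product_def)
  let ?y = "(\<alpha> (inv\<^bsub>H\<^esub> p) (inv\<^bsub>G\<^esub> c), inv\<^bsub>H\<^esub> p)"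
  have "\<alpha> (inv\<^bsub>H\<^esub> p) (inv\<^bsub>G\<^esub> c) \<otimes>\<^bsub>G\<^esub> \<alpha> (inv\<^bsub>H\<^esub> p) c = \<alpha> (inv\<^bsub>H\<^esub> p) \<one>\<^bsub>G\<^esub>"
    using x by (simp flip: action_mult)
  also have "\<dots> = \<one>\<^bsub>G\<^esub>"
    using x action_mult[of "inv\<^bsub>H\<^esub> p" "\<one>\<^bsub>G\<^esub>" "\<one>\<^bsub>G\<^esub>"] action_closed[of "inv\<^bsub>H\<^esub> p" "\<one>\<^bsub>G\<^esub>"] by simp
  finally show "\<exists>y\<in>carrier (semidirect_product G H \<alpha>).
      y \<otimes>\<^bsub>semidirect_product G H \<alpha>\<^esub> x = \<one>\<^bsub>semidirect_product G H \<alpha>\<^esub>"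
    using x action_closed by (intro bexI[of _ ?y]) (auto simp: semidirect_product_def)
qed (auto simp: semidirect_product_def action_closed action_mult action_comp action_one
       m_assoc base.m_assoc)

end

section \<open>Charming halos and lamp growth\<close>

text \<open>
  The second clause also compares infinite connected sets, hence equipollence instead of
  \<^const>\<open>card\<close>.
\<close>

definition charming ::
  "'v set \<Rightarrow> ('v \<times> 'v) set \<Rightarrow> ('g, 'r) monoid_scheme \<Rightarrow> ('v set \<Rightarrow> 'g set) \<Rightarrow> bool"
  where "charming X E G L \<longleftrightarrow>
    (\<exists>D. \<forall>S. connected_subset X E S \<longrightarrow>
       L S \<subseteq> generate G (\<Union>s\<in>S. L (graph_ball X E s D))) \<and>
    (\<forall>R S. connected_subset X E R \<and> connected_subset X E S \<and> R \<approx> S \<longrightarrow> L R \<approx> L S)"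

definition lamp_growth :: "'v set \<Rightarrow> ('v \<times> 'v) set \<Rightarrow> ('v set \<Rightarrow> 'g set) \<Rightarrow> nat \<Rightarrow> nat"
  where "lamp_growth X E L n =
    card (L (SOME S. connected_subset X E S \<and> finite S \<and> card S = n))"
  \<comment> \<open>The choice of \<open>S\<close> is immaterial for charming \<open>L\<close>; as \<^const>\<open>card\<close> is 0 on infinite sets,
     this is the lamp growth only when \<open>L S\<close> is finite for all finite connected \<open>S\<close>.\<close>

section \<open>Aptolic quasi-isometries and interlacing\<close>

text \<open>
  \<open>S\<close>, \<open>S'\<close> are the generating sets of the base groups \<open>H\<close>, \<open>H'\<close>, and \<open>T\<close>, \<open>T'\<close> those of the
  semidirect products.
\<close>

definition aptolic_quasi_isometry ::
  "('g, 'r) monoid_scheme \<Rightarrow> ('h, 's) monoid_scheme \<Rightarrow> ('h \<Rightarrow> 'g \<Rightarrow> 'g) \<Rightarrow> 'h set \<Rightarrow> ('g \<times> 'h) set \<Rightarrow>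
   ('k, 't) monoid_scheme \<Rightarrow> ('l, 'u) monoid_scheme \<Rightarrow> ('l \<Rightarrow> 'k \<Rightarrow> 'k) \<Rightarrow> 'l set \<Rightarrow> ('k \<times> 'l) set \<Rightarrow>
   ('g \<times> 'h \<Rightarrow> 'k \<times> 'l) \<Rightarrow> bool"
  where "aptolic_quasi_isometry G H \<alpha> S T G' H' \<alpha>' S' T' \<Psi> \<longleftrightarrow>
    (let P = semidirect_product G H \<alpha>; P' = semidirect_product G' H' \<alpha>' in
      quasi_isometry (carrier P) (cayley_edges P T) (carrier P') (cayley_edges P' T') \<Psi> \<and>
      (\<exists>f g. bij_betw f (carrier G) (carrier G') \<and>
             quasi_isometry (carrier H) (cayley_edges H S) (carrier H') (cayley_edges H' S') g \<and>
             (\<forall>c\<in>carrier G. \<forall>p\<in>carrier H. \<Psi> (c, p) = (f c, g p))))"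

definition interlaced :: "(nat \<Rightarrow> nat) \<Rightarrow> (nat \<Rightarrow> nat) \<Rightarrow> (nat \<Rightarrow> nat) \<Rightarrow> bool"
  where "interlaced \<Delta> \<phi> \<psi> \<longleftrightarrow>
    (\<exists>(C::nat) (x :: nat \<Rightarrow> nat).
      (\<exists>a b :: real. a > 0 \<and> b > 0 \<and> (\<forall>n\<ge>1. a * real n \<le> real (x n) \<and> real (x n) \<le> b * real n)) \<and>
      (\<forall>n\<ge>1. \<phi> n dvd \<psi> (x n) \<and> \<psi> (x n) dvd \<phi> (n + C * \<Delta> n)))"

end

theory Submission
  imports Defs
begin

text \<open>
  Write \<open>\<Psi> (c, p) = (f c, g p)\<close>. Both halves of the interlacing come from one principle: if a
  bijection between two groups sends every left coset of \<open>H\<close> into a left coset of a finite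
  subgroup \<open>K\<close>, then \<open>|H|\<close> divides \<open>|K|\<close> (\<open>card_dvd_of_coset_preserving\<close>).

  The cosets are transported as follows (\<open>coset_transport\<close>). For connected \<open>S\<close>, the first clause of the charming
  condition writes an element of \<open>M(S)\<close> as a product of elements of groups \<open>M(B(s, D))\<close> with \<open>s \<in> S\<close>. Multiplying
  \<open>c\<close> by one such factor \<open>m\<close> moves the vertex \<open>(c, s)\<close> of the halo product by a bounded amount,
  because after translating \<open>s\<close> to the identity \<open>m\<close> lies in the finite set \<open>M(B(1, D))\<close>. As
  \<open>\<Psi>\<close> is coarsely Lipschitz and keeps \<open>(c, s)\<close> and \<open>(c m, s)\<close> over the same point \<open>g s\<close>, the
  difference of \<open>f c\<close> and \<open>f (c m)\<close>, translated to the identity, lies in a finite set, hence in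
  some \<open>N(B(1, R))\<close>; undoing the translation, \<open>f (c m) \<in> f c N(B(g s, R))\<close>. So \<open>f\<close> maps cosets
  of \<open>M(S)\<close> into cosets of \<open>N(V)\<close> as soon as \<open>V\<close> contains the \<open>R\<close>-neighbourhood of \<open>g S\<close>.
  The same lemma applies to the inverse of \<open>f\<close>, with a coarse section \<open>\<sigma>\<close> of \<open>g\<close> in place
  of \<open>g\<close>.

  Given \<open>n\<close>, let \<open>S\<close> be connected of size \<open>n\<close> with the smallest possible boundary and let \<open>V\<close> be
  a large enough neighbourhood of \<open>g S\<close>. Then \<open>V\<close> is connected, has size \<open>\<Theta>(n)\<close>, and
  \<open>|M(S)|\<close> divides \<open>|N(V)|\<close>. Conversely \<open>\<sigma> V\<close> stays close to \<open>S\<close>, so \<open>|N(V)|\<close> divides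
  \<open>|M(Z)|\<close> for every finite connected \<open>Z\<close> containing the \<open>R'\<close>-neighbourhood of \<open>S\<close>, for a
  suitable constant \<open>R'\<close>. Paths leaving \<open>S\<close> cross its boundary, so this neighbourhood has at most
  \<open>n + C |\<partial>S|\<close> vertices, with \<open>C\<close> the size of a ball of radius \<open>R'\<close>; enlarging it to
  exactly that size gives \<open>Z\<close>. The second clause of the charming condition identifies the three
  cardinalities with values of the lamp growth sequences.
\<close>

section \<open>Connected graphs\<close>

locale connected_graph =
  fixes X :: "'v set" and E :: "('v \<times> 'v) set"
  assumes edges: "E \<subseteq> X \<times> X"
    and edges_sym: "sym E"
    and joined: "x \<in> X \<Longrightarrow> y \<in> X \<Longrightarrow> (x, y) \<in> E\<^sup>*"
begin

lemma dist_le_path: "(x, y) \<in> E ^^ n \<Longrightarrow> graph_dist E x y \<le> n"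
  unfolding graph_dist_def by (rule Least_le)

lemma geodesic:
  assumes "x \<in> X" "y \<in> X"
  shows "(x, y) \<in> E ^^ graph_dist E x y"
proof -
  have "\<exists>n. (x, y) \<in> E ^^ n"
    using joined[OF assms] by (simp add: rtrancl_power)
  then show ?thesis
    unfolding graph_dist_def by (rule LeastI_ex)
qed

lemma dist_self [simp]: "graph_dist E x x = 0"
  using dist_le_path[of x x 0] by simp

lemma dist_edge: "(x, y) \<in> E \<Longrightarrow> graph_dist E x y \<le> 1"
  using dist_le_path[of x y 1] by simp

lemma dist_triangle:
  assumes "x \<in> X" "y \<in> X" "z \<in> X"
  shows "graph_dist E x z \<le> graph_dist E x y + graph_dist E y z"
proof (rule dist_le_path)
  show "(x, z) \<in> E ^^ (graph_dist E x y + graph_dist E y z)"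
    using geodesic assms by (auto simp: relpow_add)
qed

lemma path_sym: "(x, y) \<in> E ^^ n \<Longrightarrow> (y, x) \<in> E ^^ n"
proof (induction n arbitrary: y)
  case (Suc n)
  then obtain z where "(z, x) \<in> E ^^ n" "(z, y) \<in> E" by auto
  then show ?case
    using edges_sym by (meson relpow_Suc_I2 symD)
qed simp

lemma dist_sym: "x \<in> X \<Longrightarrow> y \<in> X \<Longrightarrow> graph_dist E x y = graph_dist E y x"
  by (meson antisym dist_le_path geodesic path_sym)

lemma path_vertices: "x \<in> X \<Longrightarrow> (x, y) \<in> E ^^ n \<Longrightarrow> y \<in> X"
  using edges by (induction n arbitrary: y) auto

lemma path_in_ball:
  assumes "x \<in> X" "(x, y) \<in> E ^^ n" "n \<le> r"
  shows "(x, y) \<in> (E \<inter> graph_ball X E x r \<times> graph_ball X E x r)\<^sup>*"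
  using assms(2,3)
proof (induction n arbitrary: y)
  case (Suc n)
  then obtain z where z: "(x, z) \<in> E ^^ n" "(z, y) \<in> E" by auto
  have "z \<in> graph_ball X E x r" "y \<in> graph_ball X E x r"
    using dist_le_path[OF z(1)] dist_le_path[OF Suc.prems(1)] Suc.prems(2)
      path_vertices[OF assms(1) z(1)] path_vertices[OF assms(1) Suc.prems(1)]
    by (auto simp: graph_ball_def)
  with z Suc show ?case by (auto intro: rtrancl_into_rtrancl)
qed simp

lemma connected_subsetI:
  assumes "S \<subseteq> X" "\<And>x. x \<in> S \<Longrightarrow> (c, x) \<in> (E \<inter> S \<times> S)\<^sup>*"
  shows "connected_subset X E S"
proof -
  have "sym ((E \<inter> S \<times> S)\<^sup>*)"
    using edges_sym by (intro sym_rtrancl) (auto simp: sym_def)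
  then show ?thesis
    unfolding connected_subset_def using assms by (meson rtrancl_trans symD)
qed

text \<open>
  A coarsely Lipschitz map need not preserve connectedness, but the balls around the images of
  two neighbours overlap once their radius reaches the Lipschitz constant.
\<close>

lemma connected_thickened_image:
  assumes S: "connected_subset Y F S" and h: "h \<in> S \<rightarrow> X"
    and lipschitz: "\<And>s t. s \<in> S \<Longrightarrow> t \<in> S \<Longrightarrow> (s, t) \<in> F \<Longrightarrow> graph_dist E (h s) (h t) \<le> r"
  shows "connected_subset X E (\<Union>s\<in>S. graph_ball X E (h s) r)" (is "connected_subset X E ?U")
proof (cases "S = {}")
  case True
  then show ?thesis by (simp add: connected_subset_def)
next
  case False
  then obtain c where c: "c \<in> S" by blast
  have spoke: "(h s, y) \<in> (E \<inter> ?U \<times> ?U)\<^sup>*" if "s \<in> S" "y \<in> graph_ball X E (h s) r" for s y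
  proof -
    have "(h s, y) \<in> E ^^ graph_dist E (h s) y" "graph_dist E (h s) y \<le> r" "h s \<in> X"
      using that h geodesic by (auto simp: graph_ball_def)
    then have "(h s, y) \<in> (E \<inter> graph_ball X E (h s) r \<times> graph_ball X E (h s) r)\<^sup>*"
      by (intro path_in_ball)
    moreover have "E \<inter> graph_ball X E (h s) r \<times> graph_ball X E (h s) r \<subseteq> E \<inter> ?U \<times> ?U"
      using that by blast
    ultimately show ?thesis using rtrancl_mono by blast
  qed
  have centres: "(h c, h t) \<in> (E \<inter> ?U \<times> ?U)\<^sup>*" if "t \<in> S" for t
  proof -
    have "(c, t) \<in> (F \<inter> S \<times> S)\<^sup>*"
      using S c that by (auto simp: connected_subset_def)
    then show ?thesis
    proof induction
      case (step u v)
      then have "h v \<in> graph_ball X E (h u) r"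
        using h lipschitz by (auto simp: graph_ball_def)
      with spoke step have "(h u, h v) \<in> (E \<inter> ?U \<times> ?U)\<^sup>*" by blast
      with step.IH show ?case by (rule rtrancl_trans)
    qed simp
  qed
  show ?thesis
  proof (rule connected_subsetI[where c = "h c"])
    show "?U \<subseteq> X" by (auto simp: graph_ball_def)
    show "(h c, y) \<in> (E \<inter> ?U \<times> ?U)\<^sup>*" if "y \<in> ?U" for y
    proof -
      obtain s where "s \<in> S" "y \<in> graph_ball X E (h s) r" using \<open>y \<in> ?U\<close> by blast
      then show ?thesis using spoke centres rtrancl_trans by fast
    qed
  qed
qed

lemma connected_ball:
  assumes "x \<in> X"
  shows "connected_subset X E (graph_ball X E x r)"
  using connected_thickened_image[of UNIV "{}" "{x}" "\<lambda>s. s" r] assms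
  by (simp add: connected_subset_def)

lemma path_leaves:
  assumes "(s, y) \<in> E\<^sup>*" "s \<in> S" "y \<notin> S"
  shows "\<exists>u\<in>S. \<exists>v. v \<notin> S \<and> (u, v) \<in> E"
  using assms by (induction rule: rtrancl_induct) auto

text \<open>
  Connected sets of every prescribed larger size exist above a given one: as long as the set is
  finite it misses a vertex of the infinite graph, so it has a boundary vertex to absorb.
\<close>

lemma connected_superset_of_card:
  assumes "infinite X" "connected_subset X E S" "finite S" "S \<noteq> {}" "card S \<le> k"
  shows "\<exists>S'. S \<subseteq> S' \<and> connected_subset X E S' \<and> finite S' \<and> card S' = k"
  using assms(5)
proof (induction k rule: nat_induct_at_least)
  case base
  then show ?case using assms by blast
next
  case (Suc k)
  then obtain S' where S': "S \<subseteq> S'" "connected_subset X E S'" "finite S'" "card S' = k" by blast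
  obtain s where s: "s \<in> S'" using S' assms(4) by blast
  obtain y where "y \<in> X" "y \<notin> S'"
    using assms(1) S'(3) by (meson finite_subset subsetI)
  moreover have "s \<in> X" using S' s by (auto simp: connected_subset_def)
  ultimately obtain u v where uv: "u \<in> S'" "v \<notin> S'" "(u, v) \<in> E"
    using path_leaves[of s y S'] joined s by blast
  have "connected_subset X E (insert v S')"
  proof (rule connected_subsetI[where c = u])
    show "insert v S' \<subseteq> X" using S' uv edges by (auto simp: connected_subset_def)
    show "(u, x) \<in> (E \<inter> insert v S' \<times> insert v S')\<^sup>*" if "x \<in> insert v S'" for x
    proof (cases "x = v")
      case True
      with uv show ?thesis by auto
    next
      case False
      with that uv S' have "(u, x) \<in> (E \<inter> S' \<times> S')\<^sup>*" by (auto simp: connected_subset_def)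
      moreover have "E \<inter> S' \<times> S' \<subseteq> E \<inter> insert v S' \<times> insert v S'" by blast
      ultimately show ?thesis using rtrancl_mono by blast
    qed
  qed
  with S' uv show ?case by (intro exI[of _ "insert v S'"]) auto
qed

lemma boundary_growth_attained:
  assumes "infinite X" "n \<ge> 1"
  shows "\<exists>S. connected_subset X E S \<and> finite S \<and> card S = n \<and>
    card (vertex_boundary X E S) = boundary_growth X E n"
proof -
  obtain x where "x \<in> X" using assms(1) by (metis finite.emptyI equals0I)
  then have "connected_subset X E {x}" by (simp add: connected_subset_def)
  then obtain S where "connected_subset X E S" "finite S" "card S = n"
    using connected_superset_of_card[of "{x}" n] assms by auto
  then have "{card (vertex_boundary X E S) |S. connected_subset X E S \<and> finite S \<and> card S = n} \<noteq> {}"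
    by blast
  from Inf_nat_def1[OF this] show ?thesis
    unfolding boundary_growth_def by force
qed

lemma path_through_boundary:
  assumes "S \<subseteq> X" "s \<in> S" "(s, y) \<in> E ^^ n"
  shows "y \<in> S \<or> (\<exists>z\<in>vertex_boundary X E S. \<exists>m\<le>n. (z, y) \<in> E ^^ m)"
  using assms(3)
proof (induction n arbitrary: y)
  case 0
  then show ?case using assms by simp
next
  case (Suc n)
  then obtain w where w: "(s, w) \<in> E ^^ n" "(w, y) \<in> E" by auto
  show ?case
  proof (cases "w \<in> S")
    case True
    then show ?thesis
      using w(2) edges by (cases "y \<in> S") (auto simp: vertex_boundary_def intro!: exI[of _ 0])
  next
    case False
    with Suc.IH[OF w(1)] obtain z m where "z \<in> vertex_boundary X E S" "m \<le> n" "(z, w) \<in> E ^^ m"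
      by blast
    with w(2) show ?thesis by (intro disjI2 bexI[of _ z] exI[of _ "Suc m"]) auto
  qed
qed

text \<open>
  This is where the boundary growth enters: thickening a set only adds balls around its boundary
  vertices, because a path leaving the set crosses the boundary.
\<close>

lemma thickening_subset:
  assumes "S \<subseteq> X"
  shows "(\<Union>s\<in>S. graph_ball X E s r) \<subseteq> S \<union> (\<Union>z\<in>vertex_boundary X E S. graph_ball X E z r)"
proof
  fix y assume "y \<in> (\<Union>s\<in>S. graph_ball X E s r)"
  then obtain s where s: "s \<in> S" "y \<in> X" "graph_dist E s y \<le> r" by (auto simp: graph_ball_def)
  then have "(s, y) \<in> E ^^ graph_dist E s y" using assms geodesic by blast
  from path_through_boundary[OF assms s(1) this] s
  show "y \<in> S \<union> (\<Union>z\<in>vertex_boundary X E S. graph_ball X E z r)"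
    by (force simp: graph_ball_def dest!: dist_le_path)
qed

end

section \<open>Cayley graphs\<close>

locale cayley_graph = group G for G :: "('g, 'r) monoid_scheme" (structure) +
  fixes T :: "'g set"
  assumes generating: "finite_generating_set G T"
begin

lemma edge_sym: "(x, y) \<in> cayley_edges G T \<Longrightarrow> (y, x) \<in> cayley_edges G T"
  by (auto simp: cayley_edges_def)

lemma edge_translate:
  assumes "(x, y) \<in> cayley_edges G T" "g \<in> carrier G"
  shows "(g \<otimes> x, g \<otimes> y) \<in> cayley_edges G T"
proof -
  have "T \<subseteq> carrier G" using generating by (simp add: finite_generating_set_def)
  with assms show ?thesis
    by (auto simp: cayley_edges_def m_assoc subset_iff)
qed

lemma path_translate:
  assumes "(x, y) \<in> cayley_edges G T ^^ n" "g \<in> carrier G"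
  shows "(g \<otimes> x, g \<otimes> y) \<in> cayley_edges G T ^^ n"
  using assms by (induction n arbitrary: y) (auto intro: edge_translate)

lemma joined_to_one:
  assumes "x \<in> carrier G"
  shows "(\<one>, x) \<in> (cayley_edges G T)\<^sup>*"
proof -
  have T: "T \<subseteq> carrier G" using generating by (simp add: finite_generating_set_def)
  have translate: "(g \<otimes> x, g \<otimes> y) \<in> (cayley_edges G T)\<^sup>*"
    if "(x, y) \<in> (cayley_edges G T)\<^sup>*" "g \<in> carrier G" for x y g
    using that path_translate unfolding rtrancl_power by blast
  have "x \<in> generate G T" using assms generating by (simp add: finite_generating_set_def)
  then show ?thesis
  proof (induction rule: generate.induct)
    case (incl t)
    then show ?case
      using T by (cases "t = \<one>") (auto simp: cayley_edges_def subset_iff intro!: r_into_rtrancl)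
  next
    case (inv t)
    then have "t \<in> carrier G" using T by blast
    moreover have "(\<one>, inv t) \<in> cayley_edges G T" if "inv t \<noteq> \<one>"
    proof -
      have "\<one> = inv t \<otimes> t" "\<one> \<in> carrier G" "inv t \<in> carrier G"
        using \<open>t \<in> carrier G\<close> by simp_all
      with that[symmetric] inv show ?thesis unfolding cayley_edges_def by blast
    qed
    ultimately show ?case by (cases "inv t = \<one>") auto
  next
    case (eng g h)
    have "g \<in> carrier G" using eng.hyps(1) T generate_in_carrier by blast
    with translate[OF eng.IH(2), of g] eng.IH(1) show ?case by simp
  qed simp
qed

sublocale connected_graph "carrier G" "cayley_edges G T"
proof
  show "cayley_edges G T \<subseteq> carrier G \<times> carrier G" by (auto simp: cayley_edges_def)
  show sym: "sym (cayley_edges G T)" by (auto simp: sym_def edge_sym)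
  show "(x, y) \<in> (cayley_edges G T)\<^sup>*" if "x \<in> carrier G" "y \<in> carrier G" for x y
    using joined_to_one that sym_rtrancl[OF sym] by (meson rtrancl_trans symD)
qed

lemma dist_translate:
  assumes "g \<in> carrier G" "x \<in> carrier G" "y \<in> carrier G"
  shows "graph_dist (cayley_edges G T) (g \<otimes> x) (g \<otimes> y) = graph_dist (cayley_edges G T) x y"
proof (rule antisym)
  show "graph_dist (cayley_edges G T) (g \<otimes> x) (g \<otimes> y) \<le> graph_dist (cayley_edges G T) x y"
    using assms by (intro dist_le_path path_translate geodesic)
  have "(inv g \<otimes> (g \<otimes> x), inv g \<otimes> (g \<otimes> y))
      \<in> cayley_edges G T ^^ graph_dist (cayley_edges G T) (g \<otimes> x) (g \<otimes> y)"
    using assms by (intro path_translate geodesic) auto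
  then show "graph_dist (cayley_edges G T) x y \<le> graph_dist (cayley_edges G T) (g \<otimes> x) (g \<otimes> y)"
    using assms by (intro dist_le_path) (simp add: m_assoc[symmetric])
qed

lemma ball_translate:
  assumes "g \<in> carrier G"
  shows "graph_ball (carrier G) (cayley_edges G T) g r =
    g <# graph_ball (carrier G) (cayley_edges G T) \<one> r"
proof -
  have "y \<in> g <# graph_ball (carrier G) (cayley_edges G T) \<one> r"
    if "y \<in> carrier G" "graph_dist (cayley_edges G T) g y \<le> r" for y
  proof -
    have "y = g \<otimes> (inv g \<otimes> y)" using assms that by (simp add: m_assoc[symmetric])
    moreover have "inv g \<otimes> y \<in> graph_ball (carrier G) (cayley_edges G T) \<one> r"
      using dist_translate[of g \<one> "inv g \<otimes> y"] assms that
      by (simp add: m_assoc[symmetric] graph_ball_def)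
    ultimately show ?thesis unfolding l_coset_def by blast
  qed
  moreover have "graph_dist (cayley_edges G T) g (g \<otimes> y) = graph_dist (cayley_edges G T) \<one> y"
    if "y \<in> carrier G" for y
    using dist_translate[of g \<one> y] assms that by simp
  ultimately show ?thesis
    using assms by (auto simp: graph_ball_def l_coset_def)
qed

lemma finite_ball:
  assumes "g \<in> carrier G"
  shows "finite (graph_ball (carrier G) (cayley_edges G T) g r)"
proof -
  have neighbours: "finite (cayley_edges G T `` {x})" for x
  proof -
    have "cayley_edges G T `` {x} \<subseteq> (\<lambda>t. x \<otimes> t) ` T \<union> (\<lambda>t. x \<otimes> inv t) ` T"
    proof
      fix y assume "y \<in> cayley_edges G T `` {x}"
      then obtain t where t: "x \<in> carrier G" "y \<in> carrier G" "t \<in> T" "y = x \<otimes> t \<or> x = y \<otimes> t"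
        by (auto simp: cayley_edges_def)
      have "t \<in> carrier G" using t generating by (auto simp: finite_generating_set_def)
      then have "x = y \<otimes> t \<Longrightarrow> y = x \<otimes> inv t" using t by (simp add: m_assoc)
      with t show "y \<in> (\<lambda>t. x \<otimes> t) ` T \<union> (\<lambda>t. x \<otimes> inv t) ` T" by blast
    qed
    then show ?thesis
      using generating by (auto simp: finite_generating_set_def intro: finite_subset)
  qed
  have sphere: "finite ((cayley_edges G T ^^ n) `` {g})" for n
  proof (induction n)
    case (Suc n)
    have "(cayley_edges G T ^^ Suc n) `` {g} = (\<Union>x\<in>(cayley_edges G T ^^ n) `` {g}. cayley_edges G T `` {x})"
      by auto
    with Suc neighbours show ?case by simp
  qed simp
  have "graph_ball (carrier G) (cayley_edges G T) g r \<subseteq> (\<Union>n\<le>r. (cayley_edges G T ^^ n) `` {g})"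
    using assms geodesic by (fastforce simp: graph_ball_def)
  with sphere show ?thesis by (simp add: finite_subset)
qed

lemma card_ball:
  assumes "g \<in> carrier G"
  shows "card (graph_ball (carrier G) (cayley_edges G T) g r) =
    card (graph_ball (carrier G) (cayley_edges G T) \<one> r)"
proof -
  have "g <# U = (\<lambda>x. g \<otimes> x) ` U" for U by (auto simp: l_coset_def)
  moreover have "inj_on (\<lambda>x. g \<otimes> x) (graph_ball (carrier G) (cayley_edges G T) \<one> r)"
    using assms by (auto simp: inj_on_def graph_ball_def)
  ultimately show ?thesis by (simp add: ball_translate[OF assms] card_image)
qed

lemma finite_subset_ball:
  assumes "finite F" "F \<subseteq> carrier G"
  shows "\<exists>r. F \<subseteq> graph_ball (carrier G) (cayley_edges G T) \<one> r"
proof -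
  obtain r where "\<forall>k\<in>graph_dist (cayley_edges G T) \<one> ` F. k \<le> r"
    using assms(1) finite_nat_set_iff_bounded_le by blast
  with assms(2) show ?thesis by (intro exI[of _ r]) (auto simp: graph_ball_def)
qed

lemma card_union_balls:
  assumes "finite S" "S \<subseteq> carrier G"
  shows "card (\<Union>s\<in>S. graph_ball (carrier G) (cayley_edges G T) s r)
    \<le> card S * card (graph_ball (carrier G) (cayley_edges G T) \<one> r)"
proof -
  have "card (\<Union>s\<in>S. graph_ball (carrier G) (cayley_edges G T) s r)
      \<le> (\<Sum>s\<in>S. card (graph_ball (carrier G) (cayley_edges G T) s r))"
    by (rule card_UN_le[OF assms(1)])
  also have "\<dots> = (\<Sum>s\<in>S. card (graph_ball (carrier G) (cayley_edges G T) \<one> r))"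
    using assms(2) by (intro sum.cong card_ball) auto
  finally show ?thesis by simp
qed

lemma card_ball_pos: "card (graph_ball (carrier G) (cayley_edges G T) \<one> r) > 0"
  using finite_ball[OF one_closed, of r] by (auto simp: card_gt_0_iff graph_ball_def)

lemma finite_union_balls:
  "finite S \<Longrightarrow> S \<subseteq> carrier G \<Longrightarrow> finite (\<Union>s\<in>S. graph_ball (carrier G) (cayley_edges G T) s r)"
  using finite_ball by blast

text \<open>
  A map whose fibres have bounded diameter, such as a quasi-isometry, shrinks cardinalities by
  at most a constant factor: each fibre lies in a ball around any of its points.
\<close>

lemma card_le_card_image:
  assumes "finite S" "S \<subseteq> carrier G"
    and fibres: "\<And>s t. s \<in> S \<Longrightarrow> t \<in> S \<Longrightarrow> f s = f t \<Longrightarrow> graph_dist (cayley_edges G T) s t \<le> k"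
  shows "card S \<le> card (f ` S) * card (graph_ball (carrier G) (cayley_edges G T) \<one> k)"
proof -
  \<comment> \<open>One representative per fibre.\<close>
  let ?R = "inv_into S f ` f ` S"
  have R: "finite ?R" "?R \<subseteq> S" using assms(1) by (auto intro: inv_into_into)
  have "S \<subseteq> (\<Union>s\<in>?R. graph_ball (carrier G) (cayley_edges G T) s k)"
  proof
    fix s assume s: "s \<in> S"
    have "graph_dist (cayley_edges G T) (inv_into S f (f s)) s \<le> k"
      using s by (intro fibres) (auto intro: inv_into_into f_inv_into_f)
    with s assms(2) show "s \<in> (\<Union>s\<in>?R. graph_ball (carrier G) (cayley_edges G T) s k)"
      by (auto simp: graph_ball_def)
  qed
  then have "card S \<le> card (\<Union>s\<in>?R. graph_ball (carrier G) (cayley_edges G T) s k)"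
    using R assms(2) by (intro card_mono finite_union_balls) auto
  also have "\<dots> \<le> card ?R * card (graph_ball (carrier G) (cayley_edges G T) \<one> k)"
    using R assms(2) by (intro card_union_balls) auto
  also have "card ?R \<le> card (f ` S)" using assms(1) by (simp add: card_image_le)
  finally show ?thesis by simp
qed

lemma finite_boundary:
  assumes "finite S" "S \<subseteq> carrier G"
  shows "finite (vertex_boundary (carrier G) (cayley_edges G T) S)"
proof (rule finite_subset)
  show "vertex_boundary (carrier G) (cayley_edges G T) S
      \<subseteq> (\<Union>s\<in>S. graph_ball (carrier G) (cayley_edges G T) s 1)"
    using dist_edge by (auto simp: vertex_boundary_def graph_ball_def)
qed (rule finite_union_balls[OF assms])

lemma card_thickening:
  assumes "finite S" "S \<subseteq> carrier G"
  shows "card (\<Union>s\<in>S. graph_ball (carrier G) (cayley_edges G T) s r) \<le>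
    card S + card (graph_ball (carrier G) (cayley_edges G T) \<one> r) *
      card (vertex_boundary (carrier G) (cayley_edges G T) S)"
proof -
  let ?B = "vertex_boundary (carrier G) (cayley_edges G T) S"
  let ?U = "\<Union>z\<in>?B. graph_ball (carrier G) (cayley_edges G T) z r"
  have B: "finite ?B" "?B \<subseteq> carrier G"
    using finite_boundary[OF assms] by (auto simp: vertex_boundary_def)
  have "card (\<Union>s\<in>S. graph_ball (carrier G) (cayley_edges G T) s r) \<le> card (S \<union> ?U)"
    using finite_union_balls[OF B] assms(1) by (intro card_mono thickening_subset[OF assms(2)]) auto
  also have "\<dots> \<le> card S + card ?U" by (rule card_Un_le)
  also have "card ?U \<le> card ?B * card (graph_ball (carrier G) (cayley_edges G T) \<one> r)"
    by (rule card_union_balls[OF B])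
  finally show ?thesis by (simp add: mult.commute)
qed

end

section \<open>Counting cosets\<close>

text \<open>
  For subgroups \<open>H\<close> and \<open>K\<close> this means that \<open>\<phi>\<close> sends every left coset of \<open>H\<close> into a left coset of \<open>K\<close>.
\<close>

definition maps_cosets ::
  "('g, 'r) monoid_scheme \<Rightarrow> ('k, 't) monoid_scheme \<Rightarrow> ('g \<Rightarrow> 'k) \<Rightarrow> 'g set \<Rightarrow> 'k set \<Rightarrow> bool"
  where "maps_cosets G G' \<phi> H K \<longleftrightarrow>
    (\<forall>c\<in>carrier G. \<forall>h\<in>H. inv\<^bsub>G'\<^esub> \<phi> c \<otimes>\<^bsub>G'\<^esub> \<phi> (c \<otimes>\<^bsub>G\<^esub> h) \<in> K)"

text \<open>
  The preimage of \<open>K\<close> is stable under right multiplication by \<open>H\<close>, so it is a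
  disjoint union of left cosets of \<open>H\<close>. Since \<open>\<phi>\<close> is bijective, its size is that of \<open>K\<close>.
\<close>

lemma card_dvd_of_coset_preserving:
  assumes G: "group G" and G': "group G'" and H: "subgroup H G" and K: "subgroup K G'"
    and "finite K"
    and \<phi>: "bij_betw \<phi> (carrier G) (carrier G')"
    and cosets: "maps_cosets G G' \<phi> H K"
  shows "card H dvd card K"
proof -
  interpret G: group G by fact
  interpret G': group G' by fact
  interpret H: subgroup H G by fact
  interpret K: subgroup K G' by fact
  define U where "U = {c \<in> carrier G. \<phi> c \<in> K}"
  have "\<phi> ` U = K"
    using \<phi> K.subset by (auto simp: U_def bij_betw_def image_iff)
  then have "bij_betw \<phi> U K"
    using \<phi> by (auto simp: bij_betw_def U_def inj_on_def)
  then have U: "finite U" "card U = card K"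
    using \<open>finite K\<close> bij_betw_finite bij_betw_same_card by blast+
  have stable: "c \<otimes>\<^bsub>G\<^esub> h \<in> U" if "c \<in> U" "h \<in> H" for c h
  proof -
    have c: "c \<in> carrier G" "\<phi> c \<in> K" "h \<in> carrier G" using that by (auto simp: U_def)
    have \<phi>ch: "\<phi> (c \<otimes>\<^bsub>G\<^esub> h) \<in> carrier G'" using c \<phi> by (auto simp: bij_betw_def)
    have "\<phi> c \<otimes>\<^bsub>G'\<^esub> (inv\<^bsub>G'\<^esub> \<phi> c \<otimes>\<^bsub>G'\<^esub> \<phi> (c \<otimes>\<^bsub>G\<^esub> h)) \<in> K"
      using c cosets that by (auto simp: maps_cosets_def)
    then have "\<phi> (c \<otimes>\<^bsub>G\<^esub> h) \<in> K"
      using c \<phi>ch K.subset by (simp add: G'.m_assoc[symmetric] subset_iff)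
    then show ?thesis using c by (simp add: U_def)
  qed
  let ?C = "(\<lambda>c. c <#\<^bsub>G\<^esub> H) ` U"
  have union: "\<Union>?C = U"
  proof
    show "\<Union>?C \<subseteq> U" using stable by (auto simp: l_coset_def)
    show "U \<subseteq> \<Union>?C"
    proof
      fix c assume c: "c \<in> U"
      then have "c \<otimes>\<^bsub>G\<^esub> \<one>\<^bsub>G\<^esub> = c" by (simp add: U_def)
      then have "c \<in> c <#\<^bsub>G\<^esub> H" unfolding l_coset_def using H.one_closed by blast
      with c show "c \<in> \<Union>?C" by blast
    qed
  qed
  have "card H * card ?C = card (\<Union>?C)"
  proof (rule card_partition)
    show "finite ?C" using U by simp
    show "finite (\<Union>?C)" using U by (simp add: union)
    show "card Q = card H" if "Q \<in> ?C" for Q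
    proof -
      obtain c where "c \<in> U" and Q: "Q = c <#\<^bsub>G\<^esub> H" using \<open>Q \<in> ?C\<close> by (rule imageE)
      then have c: "c \<in> carrier G" by (simp add: U_def)
      have "Q = (\<lambda>h. c \<otimes>\<^bsub>G\<^esub> h) ` H" by (auto simp: Q l_coset_def)
      moreover have "inj_on (\<lambda>h. c \<otimes>\<^bsub>G\<^esub> h) H" using c by (auto simp: inj_on_def)
      ultimately show ?thesis by (simp add: card_image)
    qed
    show "Q \<inter> Q' = {}" if "Q \<in> ?C" "Q' \<in> ?C" "Q \<noteq> Q'" for Q Q'
    proof -
      obtain c where "c \<in> U" and Q: "Q = c <#\<^bsub>G\<^esub> H" using \<open>Q \<in> ?C\<close> by (rule imageE)
      obtain c' where "c' \<in> U" and Q': "Q' = c' <#\<^bsub>G\<^esub> H" using \<open>Q' \<in> ?C\<close> by (rule imageE)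
      have c: "c \<in> carrier G" "c' \<in> carrier G" using \<open>c \<in> U\<close> \<open>c' \<in> U\<close> by (auto simp: U_def)
      have "Q = x <#\<^bsub>G\<^esub> H \<and> Q' = x <#\<^bsub>G\<^esub> H" if "x \<in> Q \<inter> Q'" for x
        using that c G.l_repr_independence[OF _ _ H] unfolding Q Q' by blast
      with \<open>Q \<noteq> Q'\<close> show ?thesis by blast
    qed
  qed
  then show ?thesis using U by (metis union dvd_triv_left)
qed

section \<open>Halo products\<close>

text \<open>
  The difference between two colourings \<open>c\<close> and \<open>c'\<close>, seen from the position \<open>p\<close>: in the
  semidirect product, \<open>(c, p)\<inverse> (c', p) = (displacement p c c', \<one>)\<close>.
\<close>

definition displacement ::
  "('g, 'r) monoid_scheme \<Rightarrow> ('h, 's) monoid_scheme \<Rightarrow> ('h \<Rightarrow> 'g \<Rightarrow> 'g) \<Rightarrow> 'h \<Rightarrow> 'g \<Rightarrow> 'g \<Rightarrow> 'g"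
  where "displacement G H \<alpha> p c c' = \<alpha> (inv\<^bsub>H\<^esub> p) (inv\<^bsub>G\<^esub> c \<otimes>\<^bsub>G\<^esub> c')"

lemma charming_card_eq:
  assumes "charming X E G L" "connected_subset X E R" "finite R" "finite (L R)"
    and "connected_subset X E S" "finite S" "finite (L S)" "card R = card S"
  shows "card (L R) = card (L S)"
proof -
  have "R \<approx> S" using assms by (simp add: eqpoll_iff_card)
  then have "L R \<approx> L S" using assms unfolding charming_def by blast
  then show ?thesis using assms by (simp add: eqpoll_iff_card)
qed

text \<open>
  The arbitrary choice in the definition of lamp growth is immaterial, by the second clause of
  the charming condition.
\<close>

lemma lamp_growth_eq:
  assumes "charming X E G L" "connected_subset X E S" "finite S"
    and "\<forall>S. connected_subset X E S \<longrightarrow> finite S \<longrightarrow> finite (L S)"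
  shows "lamp_growth X E L (card S) = card (L S)"
proof -
  let ?R = "SOME R. connected_subset X E R \<and> finite R \<and> card R = card S"
  have "connected_subset X E ?R \<and> finite ?R \<and> card ?R = card S"
    by (rule someI[of _ S]) (simp add: assms)
  then show ?thesis
    unfolding lamp_growth_def using assms by (intro charming_card_eq[OF assms(1)]) auto
qed

context halo
begin

text \<open>
  Every colouring has finite support: the elements supported on finite sets form a subgroup
  that contains a generating set.
\<close>

lemma finite_support_one:
  assumes "c \<in> carrier G"
  shows "\<exists>F. finite F \<and> F \<subseteq> X \<and> c \<in> L F"
proof -
  have "c \<in> generate G (\<Union>{L S |S. S \<subseteq> X \<and> finite S})"
    using assms halo_whole halo_generated by simp
  then show ?thesis
  proof (induction rule: generate.induct)
    case one
    then show ?case using halo_empty by (intro exI[of _ "{}"]) simp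
  next
    case (incl h)
    then show ?case by blast
  next
    case (inv h)
    then obtain S where "finite S" "S \<subseteq> X" "h \<in> L S" by blast
    then show ?case using subgroup.m_inv_closed[OF halo_subgroup] by blast
  next
    case (eng h k)
    then obtain R S where "finite R" "R \<subseteq> X" "h \<in> L R" "finite S" "S \<subseteq> X" "k \<in> L S" by blast
    moreover from this have "h \<in> L (R \<union> S)" "k \<in> L (R \<union> S)"
      using halo_mono[of _ "R \<union> S"] by auto
    ultimately show ?case
      using subgroup.m_closed[OF halo_subgroup[of "R \<union> S"]] by (intro exI[of _ "R \<union> S"]) auto
  qed
qed

lemma finite_support:
  assumes "finite C" "C \<subseteq> carrier G"
  shows "\<exists>F. finite F \<and> F \<subseteq> X \<and> C \<subseteq> L F"
  using assms
proof (induction C rule: finite_induct)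
  case (insert c C)
  then obtain F F' where "finite F" "F \<subseteq> X" "C \<subseteq> L F" "finite F'" "F' \<subseteq> X" "c \<in> L F'"
    using finite_support_one by (metis insert_subset)
  moreover from this have "L F \<subseteq> L (F \<union> F')" "L F' \<subseteq> L (F \<union> F')"
    using halo_mono[of _ "F \<union> F'"] by auto
  ultimately show ?case by (intro exI[of _ "F \<union> F'"]) auto
qed auto

end

context halo_product
begin

lemma displacement_closed:
  "p \<in> carrier H \<Longrightarrow> c \<in> carrier G \<Longrightarrow> c' \<in> carrier G \<Longrightarrow> displacement G H \<alpha> p c c' \<in> carrier G"
  by (simp add: displacement_def action_closed)

lemma action_displacement:
  assumes "p \<in> carrier H" "c \<in> carrier G" "c' \<in> carrier G"
  shows "\<alpha> p (displacement G H \<alpha> p c c') = inv\<^bsub>G\<^esub> c \<otimes>\<^bsub>G\<^esub> c'"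
  using assms by (simp add: displacement_def action_one flip: action_comp)

text \<open>
  Translating the base point turns supports in \<open>p S\<close> into supports in \<open>S\<close>; this moves
  statements about balls around an arbitrary \<open>p\<close> to the identity, where finiteness is uniform.
\<close>

lemma displacement_in_iff:
  assumes "p \<in> carrier H" "c \<in> carrier G" "c' \<in> carrier G" "S \<subseteq> carrier H"
  shows "displacement G H \<alpha> p c c' \<in> L S \<longleftrightarrow> inv\<^bsub>G\<^esub> c \<otimes>\<^bsub>G\<^esub> c' \<in> L (p <#\<^bsub>H\<^esub> S)"
proof
  assume "displacement G H \<alpha> p c c' \<in> L S"
  then have "\<alpha> p (displacement G H \<alpha> p c c') \<in> \<alpha> p ` L S" by blast
  then show "inv\<^bsub>G\<^esub> c \<otimes>\<^bsub>G\<^esub> c' \<in> L (p <#\<^bsub>H\<^esub> S)"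
    using assms by (simp add: action_displacement action_halo)
next
  assume "inv\<^bsub>G\<^esub> c \<otimes>\<^bsub>G\<^esub> c' \<in> L (p <#\<^bsub>H\<^esub> S)"
  then have "\<alpha> (inv\<^bsub>H\<^esub> p) (inv\<^bsub>G\<^esub> c \<otimes>\<^bsub>G\<^esub> c') \<in> \<alpha> (inv\<^bsub>H\<^esub> p) ` L (p <#\<^bsub>H\<^esub> S)" by blast
  also have "\<dots> = L (inv\<^bsub>H\<^esub> p <#\<^bsub>H\<^esub> (p <#\<^bsub>H\<^esub> S))"
    using assms base.l_coset_subset_G by (intro action_halo) auto
  also have "inv\<^bsub>H\<^esub> p <#\<^bsub>H\<^esub> (p <#\<^bsub>H\<^esub> S) = S"
    using assms by (simp add: base.lcos_m_assoc base.lcos_mult_one)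
  finally show "displacement G H \<alpha> p c c' \<in> L S" by (simp add: displacement_def)
qed

lemma action_unit: "p \<in> carrier H \<Longrightarrow> \<alpha> p \<one>\<^bsub>G\<^esub> = \<one>\<^bsub>G\<^esub>"
  using action_mult[of p "\<one>\<^bsub>G\<^esub>" "\<one>\<^bsub>G\<^esub>"] action_closed[of p "\<one>\<^bsub>G\<^esub>"] by simp

lemma dist_same_position:
  assumes "finite_generating_set (semidirect_product G H \<alpha>) T"
    and "p \<in> carrier H" "c \<in> carrier G" "c' \<in> carrier G"
  shows "graph_dist (cayley_edges (semidirect_product G H \<alpha>) T) (c, p) (c', p) =
    graph_dist (cayley_edges (semidirect_product G H \<alpha>) T) (\<one>\<^bsub>G\<^esub>, \<one>\<^bsub>H\<^esub>)
      (displacement G H \<alpha> p c c', \<one>\<^bsub>H\<^esub>)"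
proof -
  interpret P: cayley_graph "semidirect_product G H \<alpha>" T
    using group_semidirect_product assms(1)
    by (simp add: cayley_graph_def cayley_graph_axioms_def)
  have "c \<otimes>\<^bsub>G\<^esub> \<alpha> p (displacement G H \<alpha> p c c') = c'"
    using assms by (simp add: action_displacement m_assoc[symmetric])
  with P.dist_translate[of "(c, p)" "(\<one>\<^bsub>G\<^esub>, \<one>\<^bsub>H\<^esub>)" "(displacement G H \<alpha> p c c', \<one>\<^bsub>H\<^esub>)"] assms
  show ?thesis
    by (simp add: semidirect_product_def displacement_closed action_unit)
qed

lemma dist_same_colouring:
  assumes "finite_generating_set (semidirect_product G H \<alpha>) T"
    and "p \<in> carrier H" "q \<in> carrier H" "c \<in> carrier G"
  shows "graph_dist (cayley_edges (semidirect_product G H \<alpha>) T) (c, p) (c, q) =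
    graph_dist (cayley_edges (semidirect_product G H \<alpha>) T) (\<one>\<^bsub>G\<^esub>, \<one>\<^bsub>H\<^esub>)
      (\<one>\<^bsub>G\<^esub>, inv\<^bsub>H\<^esub> p \<otimes>\<^bsub>H\<^esub> q)"
proof -
  interpret P: cayley_graph "semidirect_product G H \<alpha>" T
    using group_semidirect_product assms(1)
    by (simp add: cayley_graph_def cayley_graph_axioms_def)
  have "p \<otimes>\<^bsub>H\<^esub> (inv\<^bsub>H\<^esub> p \<otimes>\<^bsub>H\<^esub> q) = q"
    using assms by (simp add: base.m_assoc[symmetric])
  with P.dist_translate[of "(c, p)" "(\<one>\<^bsub>G\<^esub>, \<one>\<^bsub>H\<^esub>)" "(\<one>\<^bsub>G\<^esub>, inv\<^bsub>H\<^esub> p \<otimes>\<^bsub>H\<^esub> q)"] assms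
  show ?thesis
    by (simp add: semidirect_product_def action_unit)
qed

text \<open>
  The next two lemmas translate between word metrics and finite sets of displacements. By
  left invariance the distance between \<open>(c, p)\<close> and \<open>(c', p)\<close> only depends on the displacement,
  and balls in the Cayley graph of the halo product are finite.
\<close>

lemma finite_displacements_bounded:
  assumes "finite_generating_set (semidirect_product G H \<alpha>) T" "finite F" "F \<subseteq> carrier G"
  shows "\<exists>Q. \<forall>p\<in>carrier H. \<forall>c\<in>carrier G. \<forall>c'\<in>carrier G. displacement G H \<alpha> p c c' \<in> F \<longrightarrow>
    graph_dist (cayley_edges (semidirect_product G H \<alpha>) T) (c, p) (c', p) \<le> Q"
proof -
  obtain Q where
    "\<forall>k\<in>(\<lambda>x. graph_dist (cayley_edges (semidirect_product G H \<alpha>) T) (\<one>\<^bsub>G\<^esub>, \<one>\<^bsub>H\<^esub>) (x, \<one>\<^bsub>H\<^esub>)) ` F. k \<le> Q"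
    using assms(2) finite_nat_set_iff_bounded_le by blast
  then show ?thesis by (auto simp: dist_same_position[OF assms(1)])
qed

lemma bounded_displacements_finite:
  assumes "finite_generating_set (semidirect_product G H \<alpha>) T"
  shows "\<exists>F. finite F \<and> F \<subseteq> carrier G \<and>
    (\<forall>p\<in>carrier H. \<forall>c\<in>carrier G. \<forall>c'\<in>carrier G.
      graph_dist (cayley_edges (semidirect_product G H \<alpha>) T) (c, p) (c', p) \<le> Q \<longrightarrow>
      displacement G H \<alpha> p c c' \<in> F)"
proof -
  interpret P: cayley_graph "semidirect_product G H \<alpha>" T
    using group_semidirect_product assms(1)
    by (simp add: cayley_graph_def cayley_graph_axioms_def)
  let ?d = "graph_dist (cayley_edges (semidirect_product G H \<alpha>) T)"
  let ?B = "graph_ball (carrier (semidirect_product G H \<alpha>))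
    (cayley_edges (semidirect_product G H \<alpha>) T) (\<one>\<^bsub>G\<^esub>, \<one>\<^bsub>H\<^esub>) Q"
  let ?F = "{x \<in> carrier G. ?d (\<one>\<^bsub>G\<^esub>, \<one>\<^bsub>H\<^esub>) (x, \<one>\<^bsub>H\<^esub>) \<le> Q}"
  have "finite ?B" by (rule P.finite_ball) (simp add: semidirect_product_def)
  moreover have "?F \<subseteq> fst ` ?B" by (force simp: graph_ball_def semidirect_product_def)
  ultimately have "finite ?F" by (meson finite_imageI finite_subset)
  then show ?thesis
    by (intro exI[of _ ?F]) (auto simp: dist_same_position[OF assms] displacement_closed)
qed

lemma dist_same_colouring_bounded:
  assumes "finite_generating_set H S" "finite_generating_set (semidirect_product G H \<alpha>) T"
  shows "\<exists>Q. \<forall>c\<in>carrier G. \<forall>p\<in>carrier H. \<forall>q\<in>carrier H.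
    graph_dist (cayley_edges H S) p q \<le> r \<longrightarrow>
    graph_dist (cayley_edges (semidirect_product G H \<alpha>) T) (c, p) (c, q) \<le> Q"
proof -
  interpret H: cayley_graph H S
    using base.is_group assms(1) by (simp add: cayley_graph_def cayley_graph_axioms_def)
  let ?B = "graph_ball (carrier H) (cayley_edges H S) \<one>\<^bsub>H\<^esub> r"
  have "finite ?B" by (rule H.finite_ball) simp
  then obtain Q where Q:
    "\<forall>k\<in>(\<lambda>x. graph_dist (cayley_edges (semidirect_product G H \<alpha>) T) (\<one>\<^bsub>G\<^esub>, \<one>\<^bsub>H\<^esub>) (\<one>\<^bsub>G\<^esub>, x)) ` ?B. k \<le> Q"
    using finite_nat_set_iff_bounded_le by blast
  have "inv\<^bsub>H\<^esub> p \<otimes>\<^bsub>H\<^esub> q \<in> ?B"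
    if "p \<in> carrier H" "q \<in> carrier H" "graph_dist (cayley_edges H S) p q \<le> r" for p q
    using that H.dist_translate[of p "\<one>\<^bsub>H\<^esub>" "inv\<^bsub>H\<^esub> p \<otimes>\<^bsub>H\<^esub> q"]
    by (simp add: graph_ball_def base.m_assoc[symmetric])
  with Q show ?thesis
    by (intro exI[of _ Q] ballI impI) (simp only: dist_same_colouring[OF assms(2)] ball_simps)
qed

end

section \<open>Transport of cosets\<close>

text \<open>
  What an aptolic quasi-isometry says about its two components, freed from word metrics: finite
  sets of displacements play the role of bounded distances. In this form the condition covers
  both the components of the quasi-isometry itself and those of a quasi-inverse.
\<close>

definition coarsely_controlled ::
  "('g, 'r) monoid_scheme \<Rightarrow> ('h, 's) monoid_scheme \<Rightarrow> ('h \<Rightarrow> 'g \<Rightarrow> 'g) \<Rightarrow>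
   ('k, 't) monoid_scheme \<Rightarrow> ('l, 'u) monoid_scheme \<Rightarrow> ('l \<Rightarrow> 'k \<Rightarrow> 'k) \<Rightarrow>
   ('h \<Rightarrow> 'l) \<Rightarrow> ('g \<Rightarrow> 'k) \<Rightarrow> bool"
  where "coarsely_controlled G H \<alpha> G' H' \<alpha>' h \<phi> \<longleftrightarrow>
    (\<forall>F. finite F \<and> F \<subseteq> carrier G \<longrightarrow>
      (\<exists>F'. finite F' \<and> F' \<subseteq> carrier G' \<and>
        (\<forall>p\<in>carrier H. \<forall>c\<in>carrier G. \<forall>c'\<in>carrier G. displacement G H \<alpha> p c c' \<in> F \<longrightarrow>
          displacement G' H' \<alpha>' (h p) (\<phi> c) (\<phi> c') \<in> F')))"

text \<open>
  The bound is required only for pairs of vertices over a common base point, since a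
  displacement compares two colourings from one position.
\<close>

lemma coarsely_controlled_of_bounded:
  assumes halos: "halo_product H G L \<alpha>" "halo_product H' G' L' \<alpha>'"
    and T: "finite_generating_set (semidirect_product G H \<alpha>) T"
    and T': "finite_generating_set (semidirect_product G' H' \<alpha>') T'"
    and maps: "h \<in> carrier H \<rightarrow> carrier H'" "\<phi> \<in> carrier G \<rightarrow> carrier G'"
    and bounded: "\<And>Q. \<exists>Q'. \<forall>p\<in>carrier H. \<forall>c\<in>carrier G. \<forall>c'\<in>carrier G.
      graph_dist (cayley_edges (semidirect_product G H \<alpha>) T) (c, p) (c', p) \<le> Q \<longrightarrow>
      graph_dist (cayley_edges (semidirect_product G' H' \<alpha>') T') (\<phi> c, h p) (\<phi> c', h p) \<le> Q'"
  shows "coarsely_controlled G H \<alpha> G' H' \<alpha>' h \<phi>"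
  unfolding coarsely_controlled_def
proof (intro allI impI)
  fix F assume F: "finite F \<and> F \<subseteq> carrier G"
  obtain Q where Q: "\<forall>p\<in>carrier H. \<forall>c\<in>carrier G. \<forall>c'\<in>carrier G. displacement G H \<alpha> p c c' \<in> F \<longrightarrow>
      graph_dist (cayley_edges (semidirect_product G H \<alpha>) T) (c, p) (c', p) \<le> Q"
    using halo_product.finite_displacements_bounded[OF halos(1) T] F by meson
  obtain Q' where Q': "\<forall>p\<in>carrier H. \<forall>c\<in>carrier G. \<forall>c'\<in>carrier G.
      graph_dist (cayley_edges (semidirect_product G H \<alpha>) T) (c, p) (c', p) \<le> Q \<longrightarrow>
      graph_dist (cayley_edges (semidirect_product G' H' \<alpha>') T') (\<phi> c, h p) (\<phi> c', h p) \<le> Q'"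
    using bounded by blast
  obtain F' where F': "finite F'" "F' \<subseteq> carrier G'"
    "\<forall>p\<in>carrier H'. \<forall>c\<in>carrier G'. \<forall>c'\<in>carrier G'.
      graph_dist (cayley_edges (semidirect_product G' H' \<alpha>') T') (c, p) (c', p) \<le> Q' \<longrightarrow>
      displacement G' H' \<alpha>' p c c' \<in> F'"
    using halo_product.bounded_displacements_finite[OF halos(2) T', of Q'] by blast
  show "\<exists>F'. finite F' \<and> F' \<subseteq> carrier G' \<and>
      (\<forall>p\<in>carrier H. \<forall>c\<in>carrier G. \<forall>c'\<in>carrier G. displacement G H \<alpha> p c c' \<in> F \<longrightarrow>
        displacement G' H' \<alpha>' (h p) (\<phi> c) (\<phi> c') \<in> F')"
  proof (intro exI[of _ F'] conjI ballI impI)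
    fix p c c' assume "p \<in> carrier H" "c \<in> carrier G" "c' \<in> carrier G" "displacement G H \<alpha> p c c' \<in> F"
    then have "graph_dist (cayley_edges (semidirect_product G' H' \<alpha>') T') (\<phi> c, h p) (\<phi> c', h p) \<le> Q'"
      "h p \<in> carrier H'" "\<phi> c \<in> carrier G'" "\<phi> c' \<in> carrier G'"
      using Q Q' maps by blast+
    then show "displacement G' H' \<alpha>' (h p) (\<phi> c) (\<phi> c') \<in> F'" using F'(3) by blast
  qed (fact F')+
qed

text \<open>
  Right multiplication by an element of \<open>L(B(v, D))\<close> changes the colouring by a finite set of
  displacements seen from \<open>v\<close>, the same set for all \<open>v\<close>; control turns this into a local change
  near \<open>h v\<close>. The elements of \<open>G\<close> by which right multiplication keeps the image under
  \<open>\<phi>\<close> in its coset of \<open>L' Y\<close> form a subgroup, so the charming condition extends the local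
  statement to all of \<open>L V\<close>.
\<close>

lemma coset_transport:
  assumes halos: "halo_product H G L \<alpha>" "halo_product H' G' L' \<alpha>'"
    and S: "finite_generating_set H S" and S': "finite_generating_set H' S'"
    and charm: "charming (carrier H) (cayley_edges H S) G L"
    and lamps: "\<forall>V. connected_subset (carrier H) (cayley_edges H S) V \<longrightarrow> finite V \<longrightarrow> finite (L V)"
    and maps: "h \<in> carrier H \<rightarrow> carrier H'" "\<phi> \<in> carrier G \<rightarrow> carrier G'"
    and controlled: "coarsely_controlled G H \<alpha> G' H' \<alpha>' h \<phi>"
  shows "\<exists>R. \<forall>V Y. connected_subset (carrier H) (cayley_edges H S) V \<longrightarrow> Y \<subseteq> carrier H' \<longrightarrow>
    (\<Union>v\<in>V. graph_ball (carrier H') (cayley_edges H' S') (h v) R) \<subseteq> Y \<longrightarrow>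
    maps_cosets G G' \<phi> (L V) (L' Y)"
proof -
  interpret L: halo_product H G L \<alpha> by fact
  interpret L': halo_product H' G' L' \<alpha>' by fact
  interpret H: cayley_graph H S
    using L.base.is_group S by (simp add: cayley_graph_def cayley_graph_axioms_def)
  interpret H': cayley_graph H' S'
    using L'.base.is_group S' by (simp add: cayley_graph_def cayley_graph_axioms_def)
  let ?ball = "graph_ball (carrier H) (cayley_edges H S)"
  let ?ball' = "graph_ball (carrier H') (cayley_edges H' S')"
  have ball_subset: "?ball p r \<subseteq> carrier H" "?ball' q r \<subseteq> carrier H'" for p q r
    by (auto simp: graph_ball_def)
  obtain D where D: "\<And>V. connected_subset (carrier H) (cayley_edges H S) V \<Longrightarrow>
      L V \<subseteq> generate G (\<Union>v\<in>V. L (?ball v D))"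
    using charm unfolding charming_def by blast
  let ?F = "L (?ball \<one>\<^bsub>H\<^esub> D)"
  have "finite ?F"
    by (intro lamps[rule_format] H.connected_ball H.finite_ball) simp_all
  moreover have "?F \<subseteq> carrier G"
    using L.halo_subgroup[OF ball_subset(1)] by (rule subgroup.subset)
  ultimately obtain F' where F': "finite F'" "F' \<subseteq> carrier G'"
    "\<forall>p\<in>carrier H. \<forall>c\<in>carrier G. \<forall>c'\<in>carrier G. displacement G H \<alpha> p c c' \<in> ?F \<longrightarrow>
      displacement G' H' \<alpha>' (h p) (\<phi> c) (\<phi> c') \<in> F'"
    using controlled unfolding coarsely_controlled_def by meson
  obtain W where W: "finite W" "W \<subseteq> carrier H'" "F' \<subseteq> L' W"
    using L'.finite_support[OF F'(1,2)] by blast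
  obtain R where "W \<subseteq> ?ball' \<one>\<^bsub>H'\<^esub> R"
    using H'.finite_subset_ball[OF W(1,2)] by blast
  from L'.halo_mono[OF this ball_subset(2)] W(3) have R: "F' \<subseteq> L' (?ball' \<one>\<^bsub>H'\<^esub> R)"
    by (rule order_trans[rotated])
  have local_change: "inv\<^bsub>G'\<^esub> \<phi> c \<otimes>\<^bsub>G'\<^esub> \<phi> (c \<otimes>\<^bsub>G\<^esub> m) \<in> L' (?ball' (h v) R)"
    if v: "v \<in> carrier H" and m: "m \<in> L (?ball v D)" and c: "c \<in> carrier G" for v m c
  proof -
    have mG: "m \<in> carrier G"
      using m subgroup.subset[OF L.halo_subgroup[OF ball_subset(1)]] by blast
    then have "inv\<^bsub>G\<^esub> c \<otimes>\<^bsub>G\<^esub> (c \<otimes>\<^bsub>G\<^esub> m) = m" using c by (simp add: L.m_assoc[symmetric])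
    then have "displacement G H \<alpha> v c (c \<otimes>\<^bsub>G\<^esub> m) \<in> ?F"
      using m mG v c ball_subset by (simp add: L.displacement_in_iff flip: H.ball_translate)
    then have "displacement G' H' \<alpha>' (h v) (\<phi> c) (\<phi> (c \<otimes>\<^bsub>G\<^esub> m)) \<in> L' (?ball' \<one>\<^bsub>H'\<^esub> R)"
      using F'(3) R v c mG by blast
    moreover have "h v \<in> carrier H'" "\<phi> c \<in> carrier G'" "\<phi> (c \<otimes>\<^bsub>G\<^esub> m) \<in> carrier G'"
      using maps v c mG by auto
    ultimately show ?thesis
      using ball_subset by (simp add: L'.displacement_in_iff flip: H'.ball_translate)
  qed
  show ?thesis
  proof (intro exI[of _ R] allI impI)
    fix V Y
    assume V: "connected_subset (carrier H) (cayley_edges H S) V"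
      and Y: "Y \<subseteq> carrier H'" "(\<Union>v\<in>V. ?ball' (h v) R) \<subseteq> Y"
    interpret Y: subgroup "L' Y" G' by (rule L'.halo_subgroup[OF Y(1)])
    define U where "U = {m \<in> carrier G. \<forall>c\<in>carrier G.
      inv\<^bsub>G'\<^esub> \<phi> c \<otimes>\<^bsub>G'\<^esub> \<phi> (c \<otimes>\<^bsub>G\<^esub> m) \<in> L' Y}"
    have \<phi>: "\<phi> x \<in> carrier G'" if "x \<in> carrier G" for x using maps that by auto
    have "subgroup U G"
    proof (rule L.subgroupI)
      show "U \<subseteq> carrier G" by (auto simp: U_def)
      have "\<one>\<^bsub>G\<^esub> \<in> U" using \<phi> by (simp add: U_def)
      then show "U \<noteq> {}" by blast
      show "inv\<^bsub>G\<^esub> x \<in> U" if x: "x \<in> U" for x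
      proof -
        have xG: "x \<in> carrier G" using x by (simp add: U_def)
        have "inv\<^bsub>G'\<^esub> \<phi> d \<otimes>\<^bsub>G'\<^esub> \<phi> (d \<otimes>\<^bsub>G\<^esub> inv\<^bsub>G\<^esub> x) \<in> L' Y" if d: "d \<in> carrier G" for d
        proof -
          let ?e = "d \<otimes>\<^bsub>G\<^esub> inv\<^bsub>G\<^esub> x"
          have e: "?e \<in> carrier G" "?e \<otimes>\<^bsub>G\<^esub> x = d" using d xG by (auto simp: L.m_assoc)
          then have "inv\<^bsub>G'\<^esub> \<phi> ?e \<otimes>\<^bsub>G'\<^esub> \<phi> d \<in> L' Y" using x by (force simp: U_def)
          then have "inv\<^bsub>G'\<^esub> (inv\<^bsub>G'\<^esub> \<phi> ?e \<otimes>\<^bsub>G'\<^esub> \<phi> d) \<in> L' Y" by (rule Y.m_inv_closed)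
          then show ?thesis using \<phi>[OF d] \<phi>[OF e(1)] by (simp add: L'.inv_mult_group)
        qed
        then show ?thesis using xG by (simp add: U_def)
      qed
      show "x \<otimes>\<^bsub>G\<^esub> y \<in> U" if x: "x \<in> U" and y: "y \<in> U" for x y
      proof -
        have xy: "x \<in> carrier G" "y \<in> carrier G" using x y by (auto simp: U_def)
        have "inv\<^bsub>G'\<^esub> \<phi> d \<otimes>\<^bsub>G'\<^esub> \<phi> (d \<otimes>\<^bsub>G\<^esub> (x \<otimes>\<^bsub>G\<^esub> y)) \<in> L' Y" if d: "d \<in> carrier G" for d
        proof -
          let ?u = "\<phi> d" and ?v = "\<phi> (d \<otimes>\<^bsub>G\<^esub> x)" and ?w = "\<phi> (d \<otimes>\<^bsub>G\<^esub> x \<otimes>\<^bsub>G\<^esub> y)"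
          have closed: "?u \<in> carrier G'" "?v \<in> carrier G'" "?w \<in> carrier G'"
            using d xy by (auto intro: \<phi>)
          have "inv\<^bsub>G'\<^esub> ?u \<otimes>\<^bsub>G'\<^esub> ?v \<in> L' Y" "inv\<^bsub>G'\<^esub> ?v \<otimes>\<^bsub>G'\<^esub> ?w \<in> L' Y"
            using x y d xy by (auto simp: U_def)
          then have "inv\<^bsub>G'\<^esub> ?u \<otimes>\<^bsub>G'\<^esub> ?v \<otimes>\<^bsub>G'\<^esub> (inv\<^bsub>G'\<^esub> ?v \<otimes>\<^bsub>G'\<^esub> ?w) \<in> L' Y"
            by (rule Y.m_closed)
          also have "inv\<^bsub>G'\<^esub> ?u \<otimes>\<^bsub>G'\<^esub> ?v \<otimes>\<^bsub>G'\<^esub> (inv\<^bsub>G'\<^esub> ?v \<otimes>\<^bsub>G'\<^esub> ?w) = inv\<^bsub>G'\<^esub> ?u \<otimes>\<^bsub>G'\<^esub> ?w"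
          proof -
            have "?v \<otimes>\<^bsub>G'\<^esub> (inv\<^bsub>G'\<^esub> ?v \<otimes>\<^bsub>G'\<^esub> ?w) = ?w"
              using closed by (simp add: L'.m_assoc[symmetric])
            then show ?thesis using closed by (simp add: L'.m_assoc)
          qed
          finally show ?thesis using d xy by (simp add: L.m_assoc)
        qed
        then show ?thesis using xy by (simp add: U_def)
      qed
    qed
    moreover have "(\<Union>v\<in>V. L (?ball v D)) \<subseteq> U"
    proof
      fix x assume "x \<in> (\<Union>v\<in>V. L (?ball v D))"
      then obtain v where v: "v \<in> V" "x \<in> L (?ball v D)" by blast
      have vH: "v \<in> carrier H" using v V by (auto simp: connected_subset_def)
      have "x \<in> carrier G" using v subgroup.subset[OF L.halo_subgroup[OF ball_subset(1)]] by blast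
      moreover have "L' (?ball' (h v) R) \<subseteq> L' Y" using v Y by (intro L'.halo_mono) auto
      ultimately show "x \<in> U" using local_change[OF vH v(2)] by (auto simp: U_def)
    qed
    ultimately have "generate G (\<Union>v\<in>V. L (?ball v D)) \<subseteq> U"
      by (intro L.generate_subgroup_incl)
    with D[OF V] show "maps_cosets G G' \<phi> (L V) (L' Y)"
      by (auto simp: U_def maps_cosets_def)
  qed
qed

section \<open>Interlacing\<close>

text \<open>
  A single natural constant replaces the two real ones, which keeps the distance estimates
  within the natural numbers.
\<close>

lemma quasi_isometry_nat_constant:
  assumes "quasi_isometry X E Y F f"
  shows "\<exists>k. (\<forall>x\<in>X. \<forall>x'\<in>X. graph_dist F (f x) (f x') \<le> k * graph_dist E x x' + k \<and>
      graph_dist E x x' \<le> k * graph_dist F (f x) (f x') + k) \<and>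
    (\<forall>y\<in>Y. \<exists>x\<in>X. graph_dist F (f x) y \<le> k)"
proof -
  obtain K C :: real where KC: "K \<ge> 1" "C \<ge> 0"
    and lower: "\<And>x x'. x \<in> X \<Longrightarrow> x' \<in> X \<Longrightarrow>
      real (graph_dist E x x') / K - C \<le> real (graph_dist F (f x) (f x'))"
    and upper: "\<And>x x'. x \<in> X \<Longrightarrow> x' \<in> X \<Longrightarrow>
      real (graph_dist F (f x) (f x')) \<le> K * real (graph_dist E x x') + C"
    and surj: "\<And>y. y \<in> Y \<Longrightarrow> \<exists>x\<in>X. real (graph_dist F (f x) y) \<le> C"
    using assms unfolding quasi_isometry_def by blast
  define k where "k = nat \<lceil>K * (C + 1)\<rceil>"
  have k: "K * (C + 1) \<le> real k" unfolding k_def by linarith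
  have "K * C \<ge> C" using KC mult_right_mono[of 1 K C] by simp
  with k KC have bounds: "K \<le> k" "C \<le> k" "K * C \<le> k" by (auto simp: distrib_left)
  show ?thesis
  proof (intro exI[of _ k] conjI ballI)
    fix x x' assume x: "x \<in> X" "x' \<in> X"
    have "K * real (graph_dist E x x') \<le> real k * real (graph_dist E x x')"
      using bounds by (intro mult_right_mono) auto
    with upper[OF x] bounds have "real (graph_dist F (f x) (f x')) \<le> real (k * graph_dist E x x' + k)"
      by simp
    then show "graph_dist F (f x) (f x') \<le> k * graph_dist E x x' + k" by linarith
    have "K * real (graph_dist F (f x) (f x')) \<le> real k * real (graph_dist F (f x) (f x'))"
      using bounds by (intro mult_right_mono) auto
    moreover have "real (graph_dist E x x') \<le> K * real (graph_dist F (f x) (f x')) + K * C"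
      using lower[OF x] KC by (simp add: field_simps)
    ultimately have "real (graph_dist E x x') \<le> real (k * graph_dist F (f x) (f x') + k)"
      using bounds by simp
    then show "graph_dist E x x' \<le> k * graph_dist F (f x) (f x') + k" by linarith
  next
    fix y assume "y \<in> Y"
    with surj bounds show "\<exists>x\<in>X. graph_dist F (f x) y \<le> k"
      by (metis of_nat_le_iff order_trans)
  qed
qed

theorem theorem1p13:
  fixes A :: "('a, 'r) monoid_scheme" and GM :: "('m, 's) monoid_scheme"
    and M :: "'a set \<Rightarrow> 'm set" and \<alpha> :: "'a \<Rightarrow> 'm \<Rightarrow> 'm"
    and B :: "('b, 't) monoid_scheme" and GN :: "('n, 'u) monoid_scheme"
    and N :: "'b set \<Rightarrow> 'n set" and \<beta> :: "'b \<Rightarrow> 'n \<Rightarrow> 'n"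
    and S\<^sub>A :: "'a set" and T\<^sub>M :: "('m \<times> 'a) set"
    and S\<^sub>B :: "'b set" and T\<^sub>N :: "('n \<times> 'b) set"
  assumes "halo_product A GM M \<alpha>"
    and "halo_product B GN N \<beta>"
    and "finite_generating_set A S\<^sub>A"
    and "finite_generating_set B S\<^sub>B"
    and "finite_generating_set (semidirect_product GM A \<alpha>) T\<^sub>M"
    and "finite_generating_set (semidirect_product GN B \<beta>) T\<^sub>N"
    and "infinite (carrier A)"
    and "infinite (carrier B)"
    and "charming (carrier A) (cayley_edges A S\<^sub>A) GM M"
    and "charming (carrier B) (cayley_edges B S\<^sub>B) GN N"
    and "locally_finite_group GM"
    and "locally_finite_group GN"
    and "\<And>S. connected_subset (carrier A) (cayley_edges A S\<^sub>A) S \<Longrightarrow> finite S \<Longrightarrow> finite (M S)"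
    and "\<And>S. connected_subset (carrier B) (cayley_edges B S\<^sub>B) S \<Longrightarrow> finite S \<Longrightarrow> finite (N S)"
    and "\<exists>\<Psi>. aptolic_quasi_isometry GM A \<alpha> S\<^sub>A T\<^sub>M GN B \<beta> S\<^sub>B T\<^sub>N \<Psi>"
  shows "interlaced (boundary_growth (carrier A) (cayley_edges A S\<^sub>A))
           (lamp_growth (carrier A) (cayley_edges A S\<^sub>A) M)
           (lamp_growth (carrier B) (cayley_edges B S\<^sub>B) N)"
proof -
  interpret M: halo_product A GM M \<alpha> by fact
  interpret N: halo_product B GN N \<beta> by fact
  interpret A: cayley_graph A S\<^sub>A
    using M.base.is_group assms(3) by (simp add: cayley_graph_def cayley_graph_axioms_def)
  interpret B: cayley_graph B S\<^sub>B
    using N.base.is_group assms(4) by (simp add: cayley_graph_def cayley_graph_axioms_def)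
  let ?P = "semidirect_product GM A \<alpha>" and ?Q = "semidirect_product GN B \<beta>"
  interpret Q: cayley_graph ?Q T\<^sub>N
    using N.group_semidirect_product assms(6) by (simp add: cayley_graph_def cayley_graph_axioms_def)
  let ?EA = "cayley_edges A S\<^sub>A" and ?EB = "cayley_edges B S\<^sub>B"
  let ?dA = "graph_dist ?EA" and ?dB = "graph_dist ?EB"
  let ?dP = "graph_dist (cayley_edges ?P T\<^sub>M)" and ?dQ = "graph_dist (cayley_edges ?Q T\<^sub>N)"
  let ?ballA = "graph_ball (carrier A) ?EA" and ?ballB = "graph_ball (carrier B) ?EB"
  obtain \<Psi> f g where \<Psi>: "quasi_isometry (carrier ?P) (cayley_edges ?P T\<^sub>M)
        (carrier ?Q) (cayley_edges ?Q T\<^sub>N) \<Psi>"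
    and f: "bij_betw f (carrier GM) (carrier GN)"
    and g: "quasi_isometry (carrier A) ?EA (carrier B) ?EB g"
    and \<Psi>_eq: "\<And>c p. c \<in> carrier GM \<Longrightarrow> p \<in> carrier A \<Longrightarrow> \<Psi> (c, p) = (f c, g p)"
    using assms(15) unfolding aptolic_quasi_isometry_def Let_def by blast
  have g_maps: "g \<in> carrier A \<rightarrow> carrier B" using g by (simp add: quasi_isometry_def)
  have f_maps: "f \<in> carrier GM \<rightarrow> carrier GN" using f by (auto simp: bij_betw_def)
  define f' where "f' = inv_into (carrier GM) f"
  have f': "bij_betw f' (carrier GN) (carrier GM)" unfolding f'_def using f by (rule bij_betw_inv_into)
  then have f'_maps: "f' \<in> carrier GN \<rightarrow> carrier GM" by (auto simp: bij_betw_def)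
  have f_f': "f (f' c) = c" if "c \<in> carrier GN" for c
    using f that unfolding f'_def by (simp add: bij_betw_inv_into_right)
  obtain k where k_upper: "\<And>x y. x \<in> carrier A \<Longrightarrow> y \<in> carrier A \<Longrightarrow> ?dB (g x) (g y) \<le> k * ?dA x y + k"
    and k_lower: "\<And>x y. x \<in> carrier A \<Longrightarrow> y \<in> carrier A \<Longrightarrow> ?dA x y \<le> k * ?dB (g x) (g y) + k"
    and k_surj: "\<forall>y\<in>carrier B. \<exists>x\<in>carrier A. ?dB (g x) y \<le> k"
    using quasi_isometry_nat_constant[OF g] by blast
  obtain l where l: "\<forall>x\<in>carrier ?P. \<forall>y\<in>carrier ?P. ?dQ (\<Psi> x) (\<Psi> y) \<le> l * ?dP x y + l \<and>
      ?dP x y \<le> l * ?dQ (\<Psi> x) (\<Psi> y) + l"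
    using quasi_isometry_nat_constant[OF \<Psi>] by blast
  have l_upper: "?dQ (f c, g p) (f c', g p) \<le> l * ?dP (c, p) (c', p) + l"
    and l_lower: "?dP (c, p) (c', p) \<le> l * ?dQ (f c, g p) (f c', g p) + l"
    if "c \<in> carrier GM" "c' \<in> carrier GM" "p \<in> carrier A" for c c' p
    using that l[rule_format, of "(c, p)" "(c', p)"] by (simp_all add: \<Psi>_eq semidirect_product_def)
  obtain \<sigma> where \<sigma>: "\<And>t. t \<in> carrier B \<Longrightarrow> \<sigma> t \<in> carrier A \<and> ?dB (g (\<sigma> t)) t \<le> k"
    using k_surj by metis
  have \<sigma>_maps: "\<sigma> \<in> carrier B \<rightarrow> carrier A" using \<sigma> by blast
  have g_\<sigma>: "g (\<sigma> t) \<in> carrier B" "?dB t (g (\<sigma> t)) \<le> k" if "t \<in> carrier B" for t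
  proof -
    show "g (\<sigma> t) \<in> carrier B" using \<sigma>[OF that] g_maps by blast
    from B.dist_sym[OF that this] show "?dB t (g (\<sigma> t)) \<le> k" using \<sigma>[OF that] by simp
  qed

  have lamps_M: "\<forall>V. connected_subset (carrier A) ?EA V \<longrightarrow> finite V \<longrightarrow> finite (M V)"
    and lamps_N: "\<forall>V. connected_subset (carrier B) ?EB V \<longrightarrow> finite V \<longrightarrow> finite (N V)"
    using assms(13,14) by blast+
  have f_controlled: "coarsely_controlled GM A \<alpha> GN B \<beta> g f"
  proof (rule coarsely_controlled_of_bounded[OF assms(1,2,5,6) g_maps f_maps])
    fix Q
    show "\<exists>Q'. \<forall>p\<in>carrier A. \<forall>c\<in>carrier GM. \<forall>c'\<in>carrier GM.
        ?dP (c, p) (c', p) \<le> Q \<longrightarrow> ?dQ (f c, g p) (f c', g p) \<le> Q'"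
    proof (intro exI[of _ "l * Q + l"] ballI impI)
      fix p c c' assume *: "p \<in> carrier A" "c \<in> carrier GM" "c' \<in> carrier GM" "?dP (c, p) (c', p) \<le> Q"
      then have "l * ?dP (c, p) (c', p) \<le> l * Q" by simp
      with l_upper[OF *(2,3,1)] show "?dQ (f c, g p) (f c', g p) \<le> l * Q + l" by linarith
    qed
  qed
  obtain R1 where R1: "\<And>V Y. connected_subset (carrier A) ?EA V \<Longrightarrow> Y \<subseteq> carrier B \<Longrightarrow>
      (\<Union>v\<in>V. ?ballB (g v) R1) \<subseteq> Y \<Longrightarrow> maps_cosets GM GN f (M V) (N Y)"
    using coset_transport[OF assms(1,2,3,4,9) lamps_M g_maps f_maps f_controlled] by blast

  \<comment> \<open>For the inverse, \<open>t\<close> and \<open>g (\<sigma> t)\<close> are only close, so the pair \<open>(c, t)\<close>, \<open>(c', t)\<close>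
    is first moved over to the base point \<open>g (\<sigma> t)\<close>, at bounded cost \<open>q\<close> at either end.\<close>
  have f'_controlled: "coarsely_controlled GN B \<beta> GM A \<alpha> \<sigma> f'"
  proof (rule coarsely_controlled_of_bounded[OF assms(2,1,6,5) \<sigma>_maps f'_maps])
    fix Q
    obtain q where q: "\<And>c s t. c \<in> carrier GN \<Longrightarrow> s \<in> carrier B \<Longrightarrow> t \<in> carrier B \<Longrightarrow>
        ?dB s t \<le> k \<Longrightarrow> ?dQ (c, s) (c, t) \<le> q"
      using N.dist_same_colouring_bounded[OF assms(4,6), of k] by blast
    show "\<exists>Q'. \<forall>p\<in>carrier B. \<forall>c\<in>carrier GN. \<forall>c'\<in>carrier GN.
        ?dQ (c, p) (c', p) \<le> Q \<longrightarrow> ?dP (f' c, \<sigma> p) (f' c', \<sigma> p) \<le> Q'"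
    proof (intro exI[of _ "l * (q + Q + q) + l"] ballI impI)
      fix t c c' assume *: "t \<in> carrier B" "c \<in> carrier GN" "c' \<in> carrier GN" "?dQ (c, t) (c', t) \<le> Q"
      let ?u = "g (\<sigma> t)"
      have u: "?u \<in> carrier B" "\<sigma> t \<in> carrier A" "?dB ?u t \<le> k" "?dB t ?u \<le> k"
        using \<sigma>[OF *(1)] g_\<sigma>[OF *(1)] by auto
      have vertices: "(c, ?u) \<in> carrier ?Q" "(c, t) \<in> carrier ?Q"
        "(c', t) \<in> carrier ?Q" "(c', ?u) \<in> carrier ?Q"
        using * u by (auto simp: semidirect_product_def)
      have "?dQ (c, ?u) (c', ?u) \<le> ?dQ (c, ?u) (c, t) + ?dQ (c, t) (c', ?u)"
        using vertices by (intro Q.dist_triangle)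
      also have "?dQ (c, t) (c', ?u) \<le> ?dQ (c, t) (c', t) + ?dQ (c', t) (c', ?u)"
        using vertices by (intro Q.dist_triangle)
      also have "?dQ (c, ?u) (c, t) \<le> q" using * u by (intro q)
      also have "?dQ (c', t) (c', ?u) \<le> q" using * u by (intro q)
      finally have "?dQ (c, ?u) (c', ?u) \<le> q + Q + q" using *(4) by simp
      then have "l * ?dQ (c, ?u) (c', ?u) \<le> l * (q + Q + q)" by (rule mult_le_mono2)
      moreover have "?dP (f' c, \<sigma> t) (f' c', \<sigma> t) \<le> l * ?dQ (c, ?u) (c', ?u) + l"
        using l_lower[of "f' c" "f' c'" "\<sigma> t"] f'_maps * u f_f' by auto
      ultimately show "?dP (f' c, \<sigma> t) (f' c', \<sigma> t) \<le> l * (q + Q + q) + l" by linarith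
    qed
  qed
  obtain R2 where R2: "\<And>V Y. connected_subset (carrier B) ?EB V \<Longrightarrow> Y \<subseteq> carrier A \<Longrightarrow>
      (\<Union>v\<in>V. ?ballA (\<sigma> v) R2) \<subseteq> Y \<Longrightarrow> maps_cosets GN GM f' (N V) (M Y)"
    using coset_transport[OF assms(2,1,4,3,10) lamps_N \<sigma>_maps f'_maps f'_controlled] by blast

  \<comment> \<open>The radius \<open>2 * k\<close> makes the neighbourhood of the image of a connected set connected, as \<open>g\<close>
    moves neighbours to points at distance at most \<open>2 * k\<close>. A point of that neighbourhood
    is carried by \<open>\<sigma>\<close> to within \<open>k * (k + r) + k\<close> of the original set.\<close>
  define r where "r = max R1 (2 * k)"
  \<comment> \<open>The summand 1 makes \<open>R\<close> at least the distance of neighbours, so that \<open>R\<close>-neighbourhoods of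
    connected sets are connected.\<close>
  define R where "R = k * (k + r) + k + R2 + 1"
  define C where "C = card (?ballA \<one>\<^bsub>A\<^esub> R)"
  define image where "image V = (\<Union>v\<in>V. ?ballB (g v) r)" for V
  have minimal: "\<exists>V. connected_subset (carrier A) ?EA V \<and> finite V \<and> card V = n \<and>
      card (vertex_boundary (carrier A) ?EA V) = boundary_growth (carrier A) ?EA n" if "n \<ge> 1" for n
    using A.boundary_growth_attained[OF assms(7) that] .
  then obtain V where V: "\<And>n. n \<ge> 1 \<Longrightarrow> connected_subset (carrier A) ?EA (V n) \<and> finite (V n) \<and>
      card (V n) = n \<and> card (vertex_boundary (carrier A) ?EA (V n)) = boundary_growth (carrier A) ?EA n"
    by metis

  have sizes: "1 / card (?ballA \<one>\<^bsub>A\<^esub> k) * real n \<le> real (card (image (V n))) \<and>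
      real (card (image (V n))) \<le> card (?ballB \<one>\<^bsub>B\<^esub> r) * real n" if "n \<ge> 1" for n
  proof -
    have Vn: "finite (V n)" "V n \<subseteq> carrier A" "card (V n) = n"
      using V[OF that] by (auto simp: connected_subset_def)
    then have gV: "finite (g ` V n)" "g ` V n \<subseteq> carrier B" using g_maps by auto
    have image_eq: "image (V n) = (\<Union>u\<in>g ` V n. ?ballB u r)" by (simp add: image_def)
    have "card (image (V n)) \<le> card (g ` V n) * card (?ballB \<one>\<^bsub>B\<^esub> r)"
      unfolding image_eq by (rule B.card_union_balls[OF gV])
    also have "\<dots> \<le> n * card (?ballB \<one>\<^bsub>B\<^esub> r)"
      using card_image_le[OF Vn(1), of g] Vn(3) by simp
    finally have upper: "card (image (V n)) \<le> card (?ballB \<one>\<^bsub>B\<^esub> r) * n" by (simp add: mult.commute)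
    have "g ` V n \<subseteq> image (V n)"
      unfolding image_eq using gV(2) by (force simp: graph_ball_def)
    then have "card (g ` V n) \<le> card (image (V n))"
      unfolding image_eq by (rule card_mono[OF B.finite_union_balls[OF gV]])
    \<comment> \<open>Points with the same image under \<open>g\<close> are at distance at most \<open>k\<close>.\<close>
    moreover have "card (V n) \<le> card (g ` V n) * card (?ballA \<one>\<^bsub>A\<^esub> k)"
    proof (rule A.card_le_card_image[OF Vn(1,2)])
      fix s t assume "s \<in> V n" "t \<in> V n" "g s = g t"
      then show "?dA s t \<le> k" using k_lower[of s t] Vn(2) by auto
    qed
    ultimately have "n \<le> card (image (V n)) * card (?ballA \<one>\<^bsub>A\<^esub> k)"
      using Vn(3) mult_le_mono1 order_trans by metis
    then have "real n \<le> real (card (image (V n))) * real (card (?ballA \<one>\<^bsub>A\<^esub> k))"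
      by (metis of_nat_le_iff of_nat_mult)
    then have "1 / card (?ballA \<one>\<^bsub>A\<^esub> k) * real n \<le> real (card (image (V n)))"
      using A.card_ball_pos[of k] by (simp add: field_simps)
    moreover have "real (card (image (V n))) \<le> card (?ballB \<one>\<^bsub>B\<^esub> r) * real n"
      using upper by (metis of_nat_le_iff of_nat_mult)
    ultimately show ?thesis by blast
  qed

  have divides: "lamp_growth (carrier A) ?EA M n dvd lamp_growth (carrier B) ?EB N (card (image (V n))) \<and>
      lamp_growth (carrier B) ?EB N (card (image (V n))) dvd
      lamp_growth (carrier A) ?EA M (n + C * boundary_growth (carrier A) ?EA n)" if n: "n \<ge> 1" for n
  proof -
    have Vn: "connected_subset (carrier A) ?EA (V n)" "finite (V n)" "V n \<subseteq> carrier A" "card (V n) = n"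
        "card (vertex_boundary (carrier A) ?EA (V n)) = boundary_growth (carrier A) ?EA n"
      using V[OF n] by (auto simp: connected_subset_def)
    have I_conn: "connected_subset (carrier B) ?EB (image (V n))"
      unfolding image_def
    proof (rule B.connected_thickened_image[OF Vn(1)])
      show "g \<in> V n \<rightarrow> carrier B" using g_maps Vn(3) by auto
      fix s t assume st: "s \<in> V n" "t \<in> V n" "(s, t) \<in> ?EA"
      then have "k * ?dA s t \<le> k * 1" using A.dist_edge by (intro mult_le_mono2)
      moreover have "?dB (g s) (g t) \<le> k * ?dA s t + k" using st Vn(3) by (intro k_upper) auto
      ultimately have "?dB (g s) (g t) \<le> 2 * k" by linarith
      then show "?dB (g s) (g t) \<le> r" by (simp add: r_def)
    qed
    have I_fin: "finite (image (V n))"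
      unfolding image_def using Vn(2,3) g_maps by (intro finite_UN_I B.finite_ball) auto
    have I_subset: "image (V n) \<subseteq> carrier B" using I_conn by (simp add: connected_subset_def)
    have N_fin: "finite (N (image (V n)))" by (rule assms(14)[OF I_conn I_fin])
    have "card (M (V n)) dvd card (N (image (V n)))"
    proof (rule card_dvd_of_coset_preserving[OF M.group_axioms N.group_axioms
          M.halo_subgroup[OF Vn(3)] N.halo_subgroup[OF I_subset] N_fin f])
      have "(\<Union>v\<in>V n. ?ballB (g v) R1) \<subseteq> image (V n)"
        by (force simp: image_def graph_ball_def r_def)
      then show "maps_cosets GM GN f (M (V n)) (N (image (V n)))" by (rule R1[OF Vn(1) I_subset])
    qed

    let ?W = "\<Union>v\<in>V n. ?ballA v R"
    have "connected_subset (carrier A) ?EA ?W"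
      using A.connected_thickened_image[OF Vn(1), of "\<lambda>v. v" R] Vn(3) A.dist_edge
      by (force simp: R_def)
    moreover have "finite ?W" by (rule A.finite_union_balls[OF Vn(2,3)])
    moreover have "V n \<subseteq> ?W" using Vn(3) by (auto simp: graph_ball_def)
    moreover have "V n \<noteq> {}" using Vn(4) n by auto
    moreover have "card ?W \<le> n + C * boundary_growth (carrier A) ?EA n"
      using A.card_thickening[OF Vn(2,3), of R] Vn(4,5) by (simp add: C_def)
    ultimately obtain Z where Z: "?W \<subseteq> Z" "connected_subset (carrier A) ?EA Z" "finite Z"
        "card Z = n + C * boundary_growth (carrier A) ?EA n"
      using A.connected_superset_of_card[OF assms(7), of ?W] by blast
    have Z_subset: "Z \<subseteq> carrier A" using Z(2) by (simp add: connected_subset_def)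
    have "(\<Union>t\<in>image (V n). ?ballA (\<sigma> t) R2) \<subseteq> ?W"
    proof
      fix y assume "y \<in> (\<Union>t\<in>image (V n). ?ballA (\<sigma> t) R2)"
      then obtain s t where s: "s \<in> V n" and t: "t \<in> carrier B" "?dB (g s) t \<le> r"
        and y: "y \<in> carrier A" "?dA (\<sigma> t) y \<le> R2"
        by (auto simp: image_def graph_ball_def)
      have s': "s \<in> carrier A" "g s \<in> carrier B" using s Vn(3) g_maps by auto
      have \<sigma>t: "\<sigma> t \<in> carrier A" "g (\<sigma> t) \<in> carrier B" "?dB t (g (\<sigma> t)) \<le> k"
        using \<sigma>[OF t(1)] g_\<sigma>[OF t(1)] by auto
      have "?dB (g s) (g (\<sigma> t)) \<le> k + r"
        using B.dist_triangle[of "g s" t "g (\<sigma> t)"] s' t \<sigma>t by linarith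
      then have "k * ?dB (g s) (g (\<sigma> t)) \<le> k * (k + r)" by (rule mult_le_mono2)
      then have "?dA s (\<sigma> t) \<le> k * (k + r) + k"
        using k_lower[OF s'(1) \<sigma>t(1)] by linarith
      then have "?dA s y \<le> R"
        using A.dist_triangle[of s "\<sigma> t" y] s' \<sigma>t y by (simp add: R_def)
      with s y show "y \<in> ?W" by (auto simp: graph_ball_def)
    qed
    with Z(1) have near: "(\<Union>t\<in>image (V n). ?ballA (\<sigma> t) R2) \<subseteq> Z" by (rule order_trans[rotated])
    have M_fin: "finite (M Z)" by (rule assms(13)[OF Z(2,3)])
    have "card (N (image (V n))) dvd card (M Z)"
      by (rule card_dvd_of_coset_preserving[OF N.group_axioms M.group_axioms
            N.halo_subgroup[OF I_subset] M.halo_subgroup[OF Z_subset] M_fin f'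
            R2[OF I_conn Z_subset near]])
    then show ?thesis
      using \<open>card (M (V n)) dvd card (N (image (V n)))\<close>
        lamp_growth_eq[OF assms(9) Vn(1,2) lamps_M] Vn(4)
        lamp_growth_eq[OF assms(10) I_conn I_fin lamps_N]
        lamp_growth_eq[OF assms(9) Z(2,3) lamps_M] Z(4)
      by simp
  qed

  show ?thesis
    unfolding interlaced_def
  proof (intro exI[of _ C] exI[of _ "\<lambda>n. card (image (V n))"] conjI)
    show "\<exists>a b :: real. a > 0 \<and> b > 0 \<and>
        (\<forall>n\<ge>1. a * real n \<le> real (card (image (V n))) \<and> real (card (image (V n))) \<le> b * real n)"
    proof (rule exI[of _ "1 / card (?ballA \<one>\<^bsub>A\<^esub> k)"], rule exI[of _ "real (card (?ballB \<one>\<^bsub>B\<^esub> r))"],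
        intro conjI)
      show "\<forall>n\<ge>1. 1 / card (?ballA \<one>\<^bsub>A\<^esub> k) * real n \<le> real (card (image (V n))) \<and>
          real (card (image (V n))) \<le> card (?ballB \<one>\<^bsub>B\<^esub> r) * real n"
        using sizes by blast
    qed (use A.card_ball_pos[of k] B.card_ball_pos[of r] in simp_all)
  qed (use divides in blast)
qed

end
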